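(* Let $G$ be a finite-dimensional Lie group with Lie algebra $\mathfrak g$, $K\subset G$ a Lie subgroup with Lie algebra $\mathfrak k$, and $\tau:\mathfrak g\to G$ a retraction map. Assume that the (left-trivialized) Hamiltonians $h,h_1,\dots,h_N:G\times\mathfrak g^*\to\mathbb R$ are smooth and left $K$-invariant: $h(kg,\mu)=h(g,\mu)$ and $h_i(kg,\mu)=h_i(g,\mu)$ for all $k\in K$, $g\in G$, $\mu\in\mathfrak g^*$. Then the momentum map $J:T^*G\to\mathfrak k^*$ of the (cotangent lifted) action of $K$ on $G$ by left translation is $$J(g,p)=i_{\mathfrak k}^*(p\,g^{-1}),$$ where $i_{\mathfrak k}^*:\mathfrak g^*\to\mathfrak k^*$ is the dual of the Lie algebra inclusion $i_{\mathfrak k}:\mathfrak k\hookrightarrow\mathfrak g$, and $J$ is preserved by the discrete stochastic flow $F_{0,T}:(g_0,p_0)\mapsto(g_M,p_M)$ generated by the stochastic midpoint Lie group method (described in the context): $J(g_M,p_M)=J(g_0,p_0)$.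
   Context: Conventions. A retraction map $\tau:\mathfrak g\to G$ is a local diffeomorphism (near $0$) with $\tau(0)=e$. For $\xi,\eta\in\mathfrak g$, $g=\tau(\xi)$: $\mathrm d_\xi\tau^{-1}(\eta):=\mathrm D\tau^{-1}(g)\cdot(\eta g)$, with dual $[\mathrm d_\xi\tau^{-1}]^*:\mathfrak g^*\to\mathfrak g^*$. $\langle\mathrm{Ad}^*_g\mu,\eta\rangle=\langle\mu,\mathrm{Ad}_g\eta\rangle$. For $p\in T^*_gG$: $g^{-1}p\in\mathfrak g^*$ and $pg^{-1}\in\mathfrak g^*$ are the left and right translates, $\langle g^{-1}p,\eta\rangle=\langle p,g\eta\rangle$, $\langle pg^{-1},\eta\rangle=\langle p,\eta g\rangle$; for $\mu\in\mathfrak g^*$, $g\mu\in T^*_gG$ is the left translate. The momentum map of the cotangent lift of an action of $K$ on a manifold $Q$ is $\langle J(q,p),\zeta\rangle=\langle p,\zeta_Q(q)\rangle$, $\zeta\in\mathfrak k$, with $\zeta_Q$ the infinitesimal generator. Scheme. Let $\Delta t>0$, $M\ge1$, $T=M\Delta t$, $\Delta W^i_k$ ($k=1,\dots,M$) the increments of independent Wiener processes over the $k$-th step (everything is pathwise), and $\mathsf h_k:=h+\sum_{i=1}^N h_i\,\Delta W^i_k/\Delta t$. The unknowns are $g_k,\tilde g_k\in G$ and $\tilde\mu^1_k,\tilde\mu^2_k\in\mathfrak g^*$. With $\Delta t\,\xi_k=\tau^{-1}(\tilde g_k^{-1}g_k)$, $\Delta t\,\tilde\xi_k=\tau^{-1}(g_{k-1}^{-1}\tilde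 g_k)$ and derivatives of $\mathsf h_k$ evaluated at $(\tilde g_k,\frac{\tilde\mu^1_k+\tilde\mu^2_k}2)$, the method is $$\tfrac1{\Delta t}\big(\mathrm{Ad}^*_{\tau(\Delta t\tilde\xi_k)}[\mathrm d_{\Delta t\tilde\xi_k}\tau^{-1}]^*\tilde\mu^1_k-[\mathrm d_{\Delta t\xi_k}\tau^{-1}]^*\tilde\mu^2_k\big)=\tilde g_k^{-1}\tfrac{\partial\mathsf h_k}{\partial g},\qquad \tilde\xi_k=\xi_k=\tfrac12\tfrac{\partial\mathsf h_k}{\partial\mu}\quad(k=1,\dots,M),$$ $$\mathrm{Ad}^*_{\tau(\Delta t\xi_k)}[\mathrm d_{\Delta t\xi_k}\tau^{-1}]^*\tilde\mu^2_k=[\mathrm d_{\Delta t\tilde\xi_{k+1}}\tau^{-1}]^*\tilde\mu^1_{k+1}\quad(k=1,\dots,M-1).$$ The endpoint momenta are $p_0=g_0[\mathrm d_{\Delta t\tilde\xi_1}\tau^{-1}]^*\tilde\mu^1_1\in T^*_{g_0}G$ and $p_M=g_M\mathrm{Ad}^*_{\tau(\Delta t\xi_M)}[\mathrm d_{\Delta t\xi_M}\tau^{-1}]^*\tilde\mu^2_M\in T^*_{g_M}G$. It is a standing assumption that the implicit equations are solvable with all arguments of $\tau^{-1}$ in its domain, so that the flow $F_{0,T}(g_0,p_0)=(g_M,p_M)$ is defined. *)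

theory Defs
  imports "HOL-Probability.Probability" "HOL-Algebra.Group"
begin

section \<open>Smooth manifolds\<close>

text \<open>\<open>Ck_on n S f\<close> is meant for open \<open>S\<close> and finite-dimensional source spaces, where it says that
  all iterated directional derivatives up to order \<open>n\<close> exist and are continuous.\<close>

primrec Ck_on :: "nat \<Rightarrow> 'a::real_normed_vector set \<Rightarrow> ('a \<Rightarrow> 'b::real_normed_vector) \<Rightarrow> bool" where
  "Ck_on 0 S f \<longleftrightarrow> continuous_on S f"
| "Ck_on (Suc n) S f \<longleftrightarrow> (\<forall>x\<in>S. f differentiable (at x)) \<and>
     (\<forall>v. Ck_on n S (\<lambda>x. frechet_derivative f (at x) v))"

definition smooth_on :: "'a::real_normed_vector set \<Rightarrow> ('a \<Rightarrow> 'b::real_normed_vector) \<Rightarrow> bool" where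
  "smooth_on S f \<longleftrightarrow> (\<forall>n. Ck_on n S f)"

text \<open>Manifolds are modelled on a finite-dimensional normed space \<open>'e\<close>. The class
  \<open>euclidean_space\<close> would exclude dimension \<open>0\<close>, and with it discrete subgroups. A chart is
  a pair of a coordinate domain and a coordinate map.\<close>

record ('a, 'e) manifold =
  mtop :: "'a topology"
  atlas :: "('a set \<times> ('a \<Rightarrow> 'e)) set"

definition smooth_manifold :: "('a, 'e::real_normed_vector) manifold \<Rightarrow> bool" where
  "smooth_manifold M \<longleftrightarrow>
     (\<exists>B::'e set. finite B \<and> span B = UNIV) \<and>
     Hausdorff_space (mtop M) \<and> second_countable (mtop M) \<and>
     topspace (mtop M) = (\<Union>(U, \<phi>)\<in>atlas M. U) \<and>
     (\<forall>(U, \<phi>)\<in>atlas M. openin (mtop M) U \<and> open (\<phi> ` U) \<and>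
        homeomorphic_map (subtopology (mtop M) U) (top_of_set (\<phi> ` U)) \<phi>) \<and>
     (\<forall>(U, \<phi>)\<in>atlas M. \<forall>(V, \<psi>)\<in>atlas M.
        smooth_on (\<phi> ` (U \<inter> V)) (\<lambda>u. \<psi> (inv_into U \<phi> u)))"

definition smooth_map_on ::
  "'a set \<Rightarrow> ('a, 'e::real_normed_vector) manifold \<Rightarrow> ('b, 'f::real_normed_vector) manifold \<Rightarrow> ('a \<Rightarrow> 'b) \<Rightarrow> bool"
where
  "smooth_map_on S M N f \<longleftrightarrow>
     openin (mtop M) S \<and> continuous_map (subtopology (mtop M) S) (mtop N) f \<and>
     (\<forall>(U, \<phi>)\<in>atlas M. \<forall>(V, \<psi>)\<in>atlas N.
        smooth_on (\<phi> ` {x \<in> U \<inter> S. f x \<in> V}) (\<lambda>u. \<psi> (f (inv_into U \<phi> u))))"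

abbreviation smooth_map ::
  "('a, 'e::real_normed_vector) manifold \<Rightarrow> ('b, 'f::real_normed_vector) manifold \<Rightarrow> ('a \<Rightarrow> 'b) \<Rightarrow> bool"
where
  "smooth_map M N f \<equiv> smooth_map_on (topspace (mtop M)) M N f"

definition vs_manifold :: "('e::real_normed_vector, 'e) manifold" where
  "vs_manifold = \<lparr>mtop = euclidean, atlas = {(UNIV, \<lambda>x. x)}\<rparr>"

definition prod_manifold ::
  "('a, 'e) manifold \<Rightarrow> ('b, 'f) manifold \<Rightarrow> ('a \<times> 'b, 'e \<times> 'f) manifold" where
  "prod_manifold M N = \<lparr>mtop = prod_topology (mtop M) (mtop N),
     atlas = {(U \<times> V, map_prod \<phi> \<psi>) | U \<phi> V \<psi>. (U, \<phi>) \<in> atlas M \<and> (V, \<psi>) \<in> atlas N}\<rparr>"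

text \<open>The tangent space of \<open>M\<close> at \<open>x\<close> is \<open>'e\<close>, read in one fixed (arbitrarily chosen) chart
  \<open>chart_at M x\<close> around \<open>x\<close>; the cotangent space at \<open>x\<close> is accordingly the dual
  \<open>'e \<Rightarrow>\<^sub>L real\<close>, and \<open>mderiv M N f x\<close> is the tangent map of \<open>f\<close> at \<open>x\<close>, from the tangent space
  of \<open>M\<close> at \<open>x\<close> to that of \<open>N\<close> at \<open>f x\<close>. A different choice of charts only composes these
  identifications with linear isomorphisms. On \<open>vs_manifold\<close> the only chart is
  the identity.\<close>

definition chart_at :: "('a, 'e) manifold \<Rightarrow> 'a \<Rightarrow> 'a set \<times> ('a \<Rightarrow> 'e)" where
  "chart_at M x = (SOME c. c \<in> atlas M \<and> x \<in> fst c)"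

definition mderiv ::
  "('a, 'e::real_normed_vector) manifold \<Rightarrow> ('b, 'f::real_normed_vector) manifold \<Rightarrow> ('a \<Rightarrow> 'b) \<Rightarrow> 'a \<Rightarrow> 'e \<Rightarrow>\<^sub>L 'f"
where
  "mderiv M N f x =
     (let (U, \<phi>) = chart_at M x; (V, \<psi>) = chart_at N (f x)
      in Blinfun (frechet_derivative (\<lambda>u. \<psi> (f (inv_into U \<phi> u))) (at (\<phi> x))))"

section \<open>Lie groups\<close>

record ('a, 'e) lie_group = "'a monoid" +
  man :: "('a, 'e) manifold"

definition lie_group :: "('a, 'e::real_normed_vector) lie_group \<Rightarrow> bool" where
  "lie_group G \<longleftrightarrow> group G \<and> smooth_manifold (man G) \<and> topspace (mtop (man G)) = carrier G \<and>
     smooth_map (prod_manifold (man G) (man G)) (man G) (\<lambda>(x, y). x \<otimes>\<^bsub>G\<^esub> y) \<and>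
     smooth_map (man G) (man G) (\<lambda>x. inv\<^bsub>G\<^esub> x)"

text \<open>Lie subgroups are immersed: \<open>K\<close> carries its own Lie group structure, and its topology may
  be finer than the subspace topology.\<close>

definition lie_subgroup ::
  "('a, 'f::real_normed_vector) lie_group \<Rightarrow> ('a, 'e::real_normed_vector) lie_group \<Rightarrow> bool" where
  "lie_subgroup K G \<longleftrightarrow> lie_group K \<and> subgroup (carrier K) G \<and>
     (\<forall>x\<in>carrier K. \<forall>y\<in>carrier K. x \<otimes>\<^bsub>K\<^esub> y = x \<otimes>\<^bsub>G\<^esub> y) \<and>
     smooth_map (man K) (man G) (\<lambda>x. x) \<and>
     (\<forall>x\<in>carrier K. inj (blinfun_apply (mderiv (man K) (man G) (\<lambda>x. x) x)))"

text \<open>The Lie algebra of \<open>G\<close> is the tangent space at the identity, so its carrier is \<open>'e\<close> and its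
  dual is \<open>'e \<Rightarrow>\<^sub>L real\<close>. The bracket is not needed. \<open>ltrans G g x\<close> maps the tangent space at
  \<open>x\<close> to that at \<open>g \<otimes> x\<close>, and \<open>rtrans G g x\<close> maps it to that at \<open>x \<otimes> g\<close>.\<close>

definition ltrans :: "('a, 'e::real_normed_vector) lie_group \<Rightarrow> 'a \<Rightarrow> 'a \<Rightarrow> 'e \<Rightarrow>\<^sub>L 'e" where
  "ltrans G g x = mderiv (man G) (man G) (\<lambda>y. g \<otimes>\<^bsub>G\<^esub> y) x"

definition rtrans :: "('a, 'e::real_normed_vector) lie_group \<Rightarrow> 'a \<Rightarrow> 'a \<Rightarrow> 'e \<Rightarrow>\<^sub>L 'e" where
  "rtrans G g x = mderiv (man G) (man G) (\<lambda>y. y \<otimes>\<^bsub>G\<^esub> g) x"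

definition Ad :: "('a, 'e::real_normed_vector) lie_group \<Rightarrow> 'a \<Rightarrow> 'e \<Rightarrow>\<^sub>L 'e" where
  "Ad G g = mderiv (man G) (man G) (\<lambda>x. g \<otimes>\<^bsub>G\<^esub> x \<otimes>\<^bsub>G\<^esub> inv\<^bsub>G\<^esub> g) \<one>\<^bsub>G\<^esub>"

definition dual :: "('a::real_normed_vector \<Rightarrow>\<^sub>L 'b::real_normed_vector) \<Rightarrow> ('b \<Rightarrow>\<^sub>L real) \<Rightarrow> 'a \<Rightarrow>\<^sub>L real" where
  "dual A \<mu> = \<mu> o\<^sub>L A"

text \<open>For a covector \<open>p\<close> at \<open>g\<close>: the translates \<open>g\<^sup>-\<^sup>1 p\<close> and \<open>p g\<^sup>-\<^sup>1\<close> in the dual of the Lie algebra;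
  for \<open>\<mu>\<close> in that dual: the covector \<open>g \<mu>\<close> at \<open>g\<close>.\<close>

definition cotangent_left :: "('a, 'e::real_normed_vector) lie_group \<Rightarrow> 'a \<Rightarrow> ('e \<Rightarrow>\<^sub>L real) \<Rightarrow> 'e \<Rightarrow>\<^sub>L real" where
  "cotangent_left G g p = dual (ltrans G g \<one>\<^bsub>G\<^esub>) p"

definition cotangent_right :: "('a, 'e::real_normed_vector) lie_group \<Rightarrow> 'a \<Rightarrow> ('e \<Rightarrow>\<^sub>L real) \<Rightarrow> 'e \<Rightarrow>\<^sub>L real" where
  "cotangent_right G g p = dual (rtrans G g \<one>\<^bsub>G\<^esub>) p"

definition covector_at :: "('a, 'e::real_normed_vector) lie_group \<Rightarrow> 'a \<Rightarrow> ('e \<Rightarrow>\<^sub>L real) \<Rightarrow> 'e \<Rightarrow>\<^sub>L real" where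
  "covector_at G g \<mu> = dual (ltrans G (inv\<^bsub>G\<^esub> g) g) \<mu>"

section \<open>Momentum maps\<close>

text \<open>The infinitesimal generator as the tangent map at the identity of the orbit map
  \<open>k \<mapsto> k q\<close>. Equivalently it is the velocity at \<open>t = 0\<close> of \<open>c t q\<close> for any smooth curve \<open>c\<close>
  through the identity with velocity \<open>\<zeta>\<close>, such as \<open>c t = exp (t \<zeta>)\<close>
  (lemma \<open>infinitesimal_generator_curve\<close>).\<close>

definition infinitesimal_generator ::
  "('a, 'f::real_normed_vector) lie_group \<Rightarrow> ('q, 'e::real_normed_vector) manifold \<Rightarrow> ('a \<Rightarrow> 'q \<Rightarrow> 'q) \<Rightarrow>
   'q \<Rightarrow> 'f \<Rightarrow>\<^sub>L 'e"
where
  "infinitesimal_generator K Q act q = mderiv (man K) Q (\<lambda>k. act k q) \<one>\<^bsub>K\<^esub>"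

lemma chart_at_in_atlas:
  assumes "smooth_manifold M" and "x \<in> topspace (mtop M)"
  shows "chart_at M x \<in> atlas M" and "x \<in> fst (chart_at M x)"
proof -
  have "\<exists>c. c \<in> atlas M \<and> x \<in> fst c"
    using assms unfolding smooth_manifold_def by force
  then have "chart_at M x \<in> atlas M \<and> x \<in> fst (chart_at M x)"
    unfolding chart_at_def by (rule someI_ex)
  then show "chart_at M x \<in> atlas M" and "x \<in> fst (chart_at M x)" by auto
qed

lemma has_derivative_mderiv:
  assumes M: "smooth_manifold M" and N: "smooth_manifold N"
    and f: "smooth_map_on S M N f" and x: "x \<in> S"
    and c: "chart_at M x = (U, \<phi>)" and d: "chart_at N (f x) = (V, \<psi>)"
  shows "((\<lambda>u. \<psi> (f (inv_into U \<phi> u))) has_derivative blinfun_apply (mderiv M N f x)) (at (\<phi> x))"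
proof -
  have xM: "x \<in> topspace (mtop M)"
    using f x openin_subset unfolding smooth_map_on_def by blast
  have cont: "continuous_map (subtopology (mtop M) S) (mtop N) f"
    using f unfolding smooth_map_on_def by blast
  have fxN: "f x \<in> topspace (mtop N)"
    using continuous_map_image_subset_topspace[OF cont] xM x by auto
  have "(U, \<phi>) \<in> atlas M" "x \<in> U" "(V, \<psi>) \<in> atlas N" "f x \<in> V"
    using chart_at_in_atlas[OF M xM] chart_at_in_atlas[OF N fxN] c d by auto
  then have sm: "smooth_on (\<phi> ` {x \<in> U \<inter> S. f x \<in> V}) (\<lambda>u. \<psi> (f (inv_into U \<phi> u)))"
    and px: "\<phi> x \<in> \<phi> ` {x \<in> U \<inter> S. f x \<in> V}"
    using f x unfolding smooth_map_on_def by auto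
  have "Ck_on (Suc 0) (\<phi> ` {x \<in> U \<inter> S. f x \<in> V}) (\<lambda>u. \<psi> (f (inv_into U \<phi> u)))"
    using sm by (simp only: smooth_on_def)
  then have "(\<lambda>u. \<psi> (f (inv_into U \<phi> u))) differentiable (at (\<phi> x))"
    using px by (simp only: Ck_on.simps(2))
  then have *: "((\<lambda>u. \<psi> (f (inv_into U \<phi> u))) has_derivative
      frechet_derivative (\<lambda>u. \<psi> (f (inv_into U \<phi> u))) (at (\<phi> x))) (at (\<phi> x))"
    by (simp add: frechet_derivative_works)
  then have "bounded_linear (frechet_derivative (\<lambda>u. \<psi> (f (inv_into U \<phi> u))) (at (\<phi> x)))"
    by (rule has_derivative_bounded_linear)
  then show ?thesis
    using * by (simp add: mderiv_def c d bounded_linear_Blinfun_apply)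
qed

lemma mderiv_compose:
  assumes M: "smooth_manifold M" and N: "smooth_manifold N" and Q: "smooth_manifold Q"
    and f: "smooth_map M N f" and g: "smooth_map N Q g" and x: "x \<in> topspace (mtop M)"
  shows "mderiv M Q (\<lambda>y. g (f y)) x = mderiv N Q g (f x) o\<^sub>L mderiv M N f x"
proof -
  obtain U \<phi> where c: "chart_at M x = (U, \<phi>)" by (cases "chart_at M x")
  obtain V \<psi> where d: "chart_at N (f x) = (V, \<psi>)" by (cases "chart_at N (f x)")
  obtain Z \<theta> where e: "chart_at Q (g (f x)) = (Z, \<theta>)" by (cases "chart_at Q (g (f x))")
  have cont: "continuous_map (mtop M) (mtop N) f"
    using f by (simp add: smooth_map_on_def)
  have fx: "f x \<in> topspace (mtop N)"
    using continuous_map_image_subset_topspace[OF cont] x by auto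
  have U: "(U, \<phi>) \<in> atlas M" "x \<in> U" and V: "(V, \<psi>) \<in> atlas N" "f x \<in> V"
    using chart_at_in_atlas[OF M x] chart_at_in_atlas[OF N fx] c d by auto
  have hU: "homeomorphic_map (subtopology (mtop M) U) (top_of_set (\<phi> ` U)) \<phi>"
    and oU: "openin (mtop M) U" and opU: "open (\<phi> ` U)"
    using M U(1) unfolding smooth_manifold_def by auto
  have oV: "openin (mtop N) V"
    and hV: "homeomorphic_map (subtopology (mtop N) V) (top_of_set (\<psi> ` V)) \<psi>"
    using N V(1) unfolding smooth_manifold_def by auto
  have injU: "inj_on \<phi> U"
    using homeomorphic_imp_injective_map[OF hU] openin_subset[OF oU] by (simp add: inf_absorb2)
  have injV: "inj_on \<psi> V"
    using homeomorphic_imp_injective_map[OF hV] openin_subset[OF oV] by (simp add: inf_absorb2)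
  define R where "R = {y \<in> U. f y \<in> V}"
  have "openin (mtop M) {y \<in> topspace (mtop M). f y \<in> V}"
    using openin_continuous_map_preimage[OF cont oV] .
  then have "openin (mtop M) (U \<inter> {y \<in> topspace (mtop M). f y \<in> V})"
    using oU by blast
  also have "U \<inter> {y \<in> topspace (mtop M). f y \<in> V} = R"
    using openin_subset[OF oU] by (auto simp: R_def)
  finally have "openin (subtopology (mtop M) U) R"
    by (metis (no_types, lifting) R_def mem_Collect_eq oU openin_open_subtopology subsetI)
  then have "openin (top_of_set (\<phi> ` U)) (\<phi> ` R)"
    using homeomorphic_imp_open_map[OF hU] by (simp add: open_map_def)
  then have oR: "open (\<phi> ` R)"
    using opU openin_open_trans by blast
  have fd: "((\<lambda>u. \<psi> (f (inv_into U \<phi> u))) has_derivative blinfun_apply (mderiv M N f x)) (at (\<phi> x))"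
    using has_derivative_mderiv[OF M N f x c d] .
  have gd: "((\<lambda>u. \<theta> (g (inv_into V \<psi> u))) has_derivative blinfun_apply (mderiv N Q g (f x))) (at (\<psi> (f x)))"
    using has_derivative_mderiv[OF N Q g fx d e] .
  have ix: "inv_into U \<phi> (\<phi> x) = x" using injU U(2) by simp
  have "((\<lambda>u. \<theta> (g (inv_into V \<psi> (\<psi> (f (inv_into U \<phi> u)))))) has_derivative
      (\<lambda>v. mderiv N Q g (f x) (mderiv M N f x v))) (at (\<phi> x))"
    using has_derivative_compose[OF fd, of "\<lambda>u. \<theta> (g (inv_into V \<psi> u))"] gd ix by simp
  then have "((\<lambda>u. \<theta> (g (f (inv_into U \<phi> u)))) has_derivative
      (\<lambda>v. mderiv N Q g (f x) (mderiv M N f x v))) (at (\<phi> x))"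
  proof (rule has_derivative_transform_within_open[OF _ oR])
    show "\<phi> x \<in> \<phi> ` R" using U V by (auto simp: R_def)
    fix u assume "u \<in> \<phi> ` R"
    then obtain y where "y \<in> U" "f y \<in> V" "u = \<phi> y" by (auto simp: R_def)
    then show "\<theta> (g (inv_into V \<psi> (\<psi> (f (inv_into U \<phi> u))))) = \<theta> (g (f (inv_into U \<phi> u)))"
      using injU injV by simp
  qed
  then have "frechet_derivative (\<lambda>u. \<theta> (g (f (inv_into U \<phi> u)))) (at (\<phi> x)) =
      (\<lambda>v. mderiv N Q g (f x) (mderiv M N f x v))"
    by (rule frechet_derivative_at[symmetric])
  then have "mderiv M Q (\<lambda>y. g (f y)) x = Blinfun (\<lambda>v. (mderiv N Q g (f x) o\<^sub>L mderiv M N f x) v)"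
    by (simp add: mderiv_def c e)
  then show ?thesis by (simp only: blinfun_apply_inverse)
qed

lemma Ck_on_const: "Ck_on n S (\<lambda>x. c)"
  by (induction n arbitrary: c) (auto simp: frechet_derivative_const)

lemma smooth_on_id: "smooth_on S (\<lambda>x. x)"
proof -
  have "Ck_on n S (\<lambda>x. x)" for n
    by (cases n) (auto simp: frechet_derivative_ident Ck_on_const)
  then show ?thesis by (simp add: smooth_on_def)
qed

lemma smooth_manifold_real: "smooth_manifold (vs_manifold :: (real, real) manifold)"
proof -
  have "inv_into UNIV (\<lambda>x::real. x) = (\<lambda>x. x)"
    by (rule inv_equality) auto
  moreover have "\<exists>B::real set. finite B \<and> span B = UNIV"
    by (metis finite_Basis span_Basis)
  moreover have "second_countable (euclidean :: real topology)"
  proof -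
    obtain \<B> :: "real set set" where "countable \<B>" "topological_basis \<B>"
      using ex_countable_basis by blast
    then show ?thesis
      unfolding second_countable_def
      by (metis open_openin topological_basisE topological_basis_open)
  qed
  moreover have "homeomorphic_map euclidean euclidean (\<lambda>x::real. x)"
    using homeomorphic_map_id[of euclidean euclidean] by (simp add: id_def)
  ultimately show ?thesis
    by (auto simp: smooth_manifold_def vs_manifold_def smooth_on_id)
qed

lemma infinitesimal_generator_curve:
  assumes "lie_group K" and "smooth_manifold Q"
    and "smooth_map (man K) Q (\<lambda>k. act k q)"
    and "smooth_map (vs_manifold :: (real, real) manifold) (man K) c" and "c 0 = \<one>\<^bsub>K\<^esub>"
  shows "mderiv vs_manifold Q (\<lambda>t::real. act (c t) q) 0 1 =
    infinitesimal_generator K Q act q (mderiv vs_manifold (man K) c (0::real) 1)"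
  using mderiv_compose[OF smooth_manifold_real _ assms(2,4,3), of 0] assms(1,5)
  by (simp add: infinitesimal_generator_def lie_group_def vs_manifold_def)

definition momentum_map ::
  "('a, 'f::real_normed_vector) lie_group \<Rightarrow> ('q, 'e::real_normed_vector) manifold \<Rightarrow> ('a \<Rightarrow> 'q \<Rightarrow> 'q) \<Rightarrow>
   'q \<times> ('e \<Rightarrow>\<^sub>L real) \<Rightarrow> 'f \<Rightarrow>\<^sub>L real"
where
  "momentum_map K Q act = (\<lambda>(q, p). Blinfun (\<lambda>\<zeta>. p (infinitesimal_generator K Q act q \<zeta>)))"

definition lie_algebra_inclusion ::
  "('a, 'f::real_normed_vector) lie_group \<Rightarrow> ('a, 'e::real_normed_vector) lie_group \<Rightarrow> 'f \<Rightarrow>\<^sub>L 'e" where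
  "lie_algebra_inclusion K G = mderiv (man K) (man G) (\<lambda>x. x) \<one>\<^bsub>K\<^esub>"

section \<open>Retraction maps\<close>

text \<open>\<open>U\<close> is a neighbourhood of \<open>0\<close> on which \<open>\<tau>\<close> is a diffeomorphism onto an open subset of \<open>G\<close>;
  \<open>\<tau> ` U\<close> is the domain of the inverse of \<open>\<tau>\<close>.\<close>

definition lie_retraction :: "('a, 'e::real_normed_vector) lie_group \<Rightarrow> ('e \<Rightarrow> 'a) \<Rightarrow> 'e set \<Rightarrow> bool" where
  "lie_retraction G \<tau> U \<longleftrightarrow> (\<forall>\<xi>. \<tau> \<xi> \<in> carrier G) \<and> \<tau> 0 = \<one>\<^bsub>G\<^esub> \<and>
     0 \<in> U \<and> inj_on \<tau> U \<and>
     smooth_map_on U vs_manifold (man G) \<tau> \<and>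
     smooth_map_on (\<tau> ` U) (man G) vs_manifold (inv_into U \<tau>)"

definition dtau_inv :: "('a, 'e::real_normed_vector) lie_group \<Rightarrow> ('e \<Rightarrow> 'a) \<Rightarrow> 'e set \<Rightarrow> 'e \<Rightarrow> 'e \<Rightarrow>\<^sub>L 'e" where
  "dtau_inv G \<tau> U \<xi> =
     mderiv (man G) vs_manifold (inv_into U \<tau>) (\<tau> \<xi>) o\<^sub>L rtrans G (\<tau> \<xi>) \<one>\<^bsub>G\<^esub>"

section \<open>Wiener processes\<close>

definition wiener_process :: "'w measure \<Rightarrow> (real \<Rightarrow> 'w \<Rightarrow> real) \<Rightarrow> bool" where
  "wiener_process P W \<longleftrightarrow> prob_space P \<and>
     (\<forall>t\<ge>0. W t \<in> borel_measurable P) \<and>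
     (AE \<omega> in P. W 0 \<omega> = 0) \<and>
     (AE \<omega> in P. continuous_on {0..} (\<lambda>t. W t \<omega>)) \<and>
     (\<forall>s t. 0 \<le> s \<longrightarrow> s < t \<longrightarrow>
        distributed P lborel (\<lambda>\<omega>. W t \<omega> - W s \<omega>) (\<lambda>x. ennreal (normal_density 0 (sqrt (t - s)) x))) \<and>
     (\<forall>(n::nat) r. 0 \<le> r 0 \<longrightarrow> strict_mono r \<longrightarrow>
        prob_space.indep_vars P (\<lambda>_. borel) (\<lambda>j \<omega>. W (r (Suc j)) \<omega> - W (r j) \<omega>) {..<n})"

definition independent_wiener_processes :: "'w measure \<Rightarrow> nat \<Rightarrow> (nat \<Rightarrow> real \<Rightarrow> 'w \<Rightarrow> real) \<Rightarrow> bool" where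
  "independent_wiener_processes P N W \<longleftrightarrow> prob_space P \<and> (\<forall>i\<in>{1..N}. wiener_process P (W i)) \<and>
     prob_space.indep_vars P (\<lambda>_. Pi\<^sub>M {0..} (\<lambda>_. borel)) (\<lambda>i \<omega>. \<lambda>t\<in>{0..}. W i t \<omega>) {1..N}"

definition wiener_increment :: "(nat \<Rightarrow> real \<Rightarrow> 'w \<Rightarrow> real) \<Rightarrow> real \<Rightarrow> 'w \<Rightarrow> nat \<Rightarrow> nat \<Rightarrow> real" where
  "wiener_increment W \<Delta>t \<omega> i k = W i (real k * \<Delta>t) \<omega> - W i ((real k - 1) * \<Delta>t) \<omega>"

section \<open>The stochastic midpoint Lie group method\<close>

definition smooth_hamiltonian ::
  "('a, 'e::real_normed_vector) lie_group \<Rightarrow> ('a \<Rightarrow> ('e \<Rightarrow>\<^sub>L real) \<Rightarrow> real) \<Rightarrow> bool" where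
  "smooth_hamiltonian G h \<longleftrightarrow> smooth_map (prod_manifold (man G) vs_manifold) vs_manifold (\<lambda>(g, \<mu>). h g \<mu>)"

definition left_invariant_hamiltonian ::
  "('a, 'f) lie_group \<Rightarrow> ('a, 'e::real_normed_vector) lie_group \<Rightarrow> ('a \<Rightarrow> ('e \<Rightarrow>\<^sub>L real) \<Rightarrow> real) \<Rightarrow> bool" where
  "left_invariant_hamiltonian K G h \<longleftrightarrow>
     (\<forall>k\<in>carrier K. \<forall>g\<in>carrier G. \<forall>\<mu>. h (k \<otimes>\<^bsub>G\<^esub> g) \<mu> = h g \<mu>)"

definition dH_dg ::
  "('a, 'e::real_normed_vector) lie_group \<Rightarrow> ('a \<Rightarrow> ('e \<Rightarrow>\<^sub>L real) \<Rightarrow> real) \<Rightarrow> 'a \<Rightarrow> ('e \<Rightarrow>\<^sub>L real) \<Rightarrow> 'e \<Rightarrow>\<^sub>L real" where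
  "dH_dg G h g \<mu> = mderiv (man G) vs_manifold (\<lambda>x. h x \<mu>) g"

text \<open>The derivative with respect to \<open>\<mu>\<close> is a functional on the dual of the Lie algebra,
  identified with an element of the Lie algebra by biduality.\<close>

definition dH_dmu ::
  "('a \<Rightarrow> ('e::real_normed_vector \<Rightarrow>\<^sub>L real) \<Rightarrow> real) \<Rightarrow> 'a \<Rightarrow> ('e \<Rightarrow>\<^sub>L real) \<Rightarrow> 'e" where
  "dH_dmu h g \<mu> = (THE \<xi>. \<forall>\<nu>. frechet_derivative (h g) (at \<mu>) \<nu> = blinfun_apply \<nu> \<xi>)"

definition step_hamiltonian ::
  "('a \<Rightarrow> ('e::real_normed_vector \<Rightarrow>\<^sub>L real) \<Rightarrow> real) \<Rightarrow> nat \<Rightarrow> (nat \<Rightarrow> 'a \<Rightarrow> ('e \<Rightarrow>\<^sub>L real) \<Rightarrow> real) \<Rightarrow>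
   real \<Rightarrow> (nat \<Rightarrow> nat \<Rightarrow> real) \<Rightarrow> nat \<Rightarrow> 'a \<Rightarrow> ('e \<Rightarrow>\<^sub>L real) \<Rightarrow> real"
where
  "step_hamiltonian h N hs \<Delta>t \<Delta>W k g \<mu> = h g \<mu> + (\<Sum>i=1..N. hs i g \<mu> * (\<Delta>W i k / \<Delta>t))"

text \<open>\<open>discrete_velocity G \<tau> U \<Delta>t a b\<close> is the \<open>\<xi>\<close> with \<open>\<Delta>t \<xi> = \<tau>\<^sup>-\<^sup>1 (a\<^sup>-\<^sup>1 b)\<close>.\<close>

definition discrete_velocity ::
  "('a, 'e::real_normed_vector) lie_group \<Rightarrow> ('e \<Rightarrow> 'a) \<Rightarrow> 'e set \<Rightarrow> real \<Rightarrow> 'a \<Rightarrow> 'a \<Rightarrow> 'e" where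
  "discrete_velocity G \<tau> U \<Delta>t a b = (1 / \<Delta>t) *\<^sub>R inv_into U \<tau> (inv\<^bsub>G\<^esub> a \<otimes>\<^bsub>G\<^esub> b)"

text \<open>\<open>H k\<close> is the Hamiltonian of the \<open>k\<close>-th step; \<open>gt\<close>, \<open>\<mu>1\<close>, \<open>\<mu>2\<close> are the internal stages.\<close>

definition midpoint_solution ::
  "('a, 'e::real_normed_vector) lie_group \<Rightarrow> ('e \<Rightarrow> 'a) \<Rightarrow> 'e set \<Rightarrow> real \<Rightarrow> nat \<Rightarrow>
   (nat \<Rightarrow> 'a \<Rightarrow> ('e \<Rightarrow>\<^sub>L real) \<Rightarrow> real) \<Rightarrow>
   (nat \<Rightarrow> 'a) \<Rightarrow> (nat \<Rightarrow> 'a) \<Rightarrow> (nat \<Rightarrow> 'e \<Rightarrow>\<^sub>L real) \<Rightarrow> (nat \<Rightarrow> 'e \<Rightarrow>\<^sub>L real) \<Rightarrow> bool"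
where
  "midpoint_solution G \<tau> U \<Delta>t M H g gt \<mu>1 \<mu>2 \<longleftrightarrow>
    (let \<xi> = (\<lambda>k. discrete_velocity G \<tau> U \<Delta>t (gt k) (g k));
         \<xi>t = (\<lambda>k. discrete_velocity G \<tau> U \<Delta>t (g (k - 1)) (gt k));
         d = (\<lambda>\<xi>. dtau_inv G \<tau> U (\<Delta>t *\<^sub>R \<xi>));
         A = (\<lambda>\<xi>. Ad G (\<tau> (\<Delta>t *\<^sub>R \<xi>)));
         \<mu> = (\<lambda>k. (1/2) *\<^sub>R (\<mu>1 k + \<mu>2 k))
     in (\<forall>k\<in>{0..M}. g k \<in> carrier G) \<and>
        (\<forall>k\<in>{1..M}. gt k \<in> carrier G \<and>
           inv\<^bsub>G\<^esub> (gt k) \<otimes>\<^bsub>G\<^esub> g k \<in> \<tau> ` U \<and> inv\<^bsub>G\<^esub> (g (k - 1)) \<otimes>\<^bsub>G\<^esub> gt k \<in> \<tau> ` U) \<and>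
        (\<forall>k\<in>{1..M}.
           (1 / \<Delta>t) *\<^sub>R (dual (A (\<xi>t k)) (dual (d (\<xi>t k)) (\<mu>1 k)) - dual (d (\<xi> k)) (\<mu>2 k))
             = cotangent_left G (gt k) (dH_dg G (H k) (gt k) (\<mu> k)) \<and>
           \<xi>t k = \<xi> k \<and> \<xi> k = (1/2) *\<^sub>R dH_dmu (H k) (gt k) (\<mu> k)) \<and>
        (\<forall>k\<in>{1..<M}.
           dual (A (\<xi> k)) (dual (d (\<xi> k)) (\<mu>2 k)) = dual (d (\<xi>t (Suc k))) (\<mu>1 (Suc k))))"

text \<open>The discrete flow as a relation (the graph of the flow where the implicit equations
  are uniquely solvable): \<open>z0 = (g\<^sub>0, p\<^sub>0)\<close> and \<open>zM = (g\<^sub>M, p\<^sub>M)\<close> are the endpoint data of a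
  solution.\<close>

definition discrete_flow ::
  "('a, 'e::real_normed_vector) lie_group \<Rightarrow> ('e \<Rightarrow> 'a) \<Rightarrow> 'e set \<Rightarrow> real \<Rightarrow> nat \<Rightarrow>
   (nat \<Rightarrow> 'a \<Rightarrow> ('e \<Rightarrow>\<^sub>L real) \<Rightarrow> real) \<Rightarrow> 'a \<times> ('e \<Rightarrow>\<^sub>L real) \<Rightarrow> 'a \<times> ('e \<Rightarrow>\<^sub>L real) \<Rightarrow> bool"
where
  "discrete_flow G \<tau> U \<Delta>t M H z0 zM \<longleftrightarrow>
    (\<exists>g gt \<mu>1 \<mu>2. midpoint_solution G \<tau> U \<Delta>t M H g gt \<mu>1 \<mu>2 \<and>
       (let \<xi>t1 = discrete_velocity G \<tau> U \<Delta>t (g 0) (gt 1);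
            \<xi>M = discrete_velocity G \<tau> U \<Delta>t (gt M) (g M)
        in z0 = (g 0, covector_at G (g 0) (dual (dtau_inv G \<tau> U (\<Delta>t *\<^sub>R \<xi>t1)) (\<mu>1 1))) \<and>
           zM = (g M, covector_at G (g M)
                   (dual (Ad G (\<tau> (\<Delta>t *\<^sub>R \<xi>M))) (dual (dtau_inv G \<tau> U (\<Delta>t *\<^sub>R \<xi>M)) (\<mu>2 M))))))"

end

theory Submission
  imports Defs
begin

text \<open>
  This is a discrete Noether theorem. A point \<open>(g, p)\<close> of the cotangent bundle has the left momentum
  \<open>\<mu> = g\<inverse> p\<close>, and its right momentum is \<open>p g\<inverse> = Ad\<^sup>*(g\<inverse>) \<mu>\<close>. Since the generators of left translation
  are the right invariant vector fields \<open>\<zeta> g\<close>, the momentum map is the restriction of the right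
  momentum to the Lie algebra of the subgroup (\<open>momentum_map_left_translation\<close>).

  Let \<open>a\<close> be the left momentum at \<open>g\<^sub>0\<close> at the beginning of a step and let \<open>b\<close> be the one at \<open>g\<^sub>1\<close> at
  its end. The step factors through \<open>\<gamma>\<close>, with \<open>\<tau>(\<Delta>t \<xi>') = g\<^sub>0\<inverse> \<gamma>\<close> and \<open>\<tau>(\<Delta>t \<xi>) = \<gamma>\<inverse> g\<^sub>1\<close>, and
  \<open>b = Ad\<^sup>*(\<tau>(\<Delta>t \<xi>)) c\<close>, where \<open>c\<close> is the left momentum at \<open>\<gamma>\<close>. The balance equation of the step is
  \<open>Ad\<^sup>*(\<tau>(\<Delta>t \<xi>')) a - c = \<Delta>t \<gamma>\<inverse> \<partial>H/\<partial>g\<close>.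
  Transported to the right momentum by \<open>Ad\<^sup>*(\<gamma>\<inverse>)\<close>, it becomes
  \<open>Ad\<^sup>*(g\<^sub>0\<inverse>) a - Ad\<^sup>*(g\<^sub>1\<inverse>) b = \<Delta>t (\<partial>H/\<partial>g) \<gamma>\<inverse>\<close>,
  because \<open>Ad\<close> is multiplicative. The right-hand side annihilates the Lie algebra of the subgroup:
  there it is the derivative of \<open>k \<mapsto> H (k \<gamma>)\<close>, which is constant by left invariance
  (\<open>dH_dg_invariant\<close>). Hence each step preserves the restricted right momentum
  (\<open>step_momentum_balance\<close>), and the matching condition between consecutive steps lets these
  identities telescope.

  The group theory is the multiplicativity of \<open>Ad\<close> (\<open>Ad_mult\<close>) and its relation to left and right
  translation of covectors (\<open>dual_Ad_cotangent_left\<close>). The analysis consists in showing that a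
  partial map of a smooth map on a product, such as a translation of the group or a Hamiltonian at
  a fixed momentum, is smooth (\<open>smooth_map_compose_chart_affine\<close>), so that the chain rule applies
  to it.
\<close>

section \<open>Smoothness of partial maps\<close>

lemma has_derivative_cong_open:
  assumes "open S" and "x \<in> S" and "\<And>y. y \<in> S \<Longrightarrow> f y = g y"
  shows "(f has_derivative D) (at x) \<longleftrightarrow> (g has_derivative D) (at x)"
  using assms by (metis has_derivative_transform_within_open)

lemma frechet_derivative_cong_open:
  assumes "open S" and "x \<in> S" and "\<And>y. y \<in> S \<Longrightarrow> f y = g y"
  shows "frechet_derivative f (at x) = frechet_derivative g (at x)"
  unfolding frechet_derivative_def using has_derivative_cong_open[OF assms] by simp

lemma Ck_on_cong:
  assumes "open S" and "Ck_on n S f" and "\<And>y. y \<in> S \<Longrightarrow> f y = g y"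
  shows "Ck_on n S g"
  using assms(2,3)
proof (induction n arbitrary: f g)
  case 0
  then show ?case by (simp cong: continuous_on_cong)
next
  case (Suc n)
  have "g differentiable (at x)" if x: "x \<in> S" for x
  proof -
    have "f differentiable (at x)" using Suc.prems(1) x by simp
    then obtain D where "(f has_derivative D) (at x)" unfolding differentiable_def ..
    from has_derivative_transform_within_open[OF this assms(1) x Suc.prems(2)]
    show ?thesis by (rule differentiableI)
  qed
  moreover have "Ck_on n S (\<lambda>x. frechet_derivative g (at x) v)" for v
  proof (rule Suc.IH)
    show "Ck_on n S (\<lambda>x. frechet_derivative f (at x) v)"
      using Suc.prems(1) by simp
    show "frechet_derivative f (at y) v = frechet_derivative g (at y) v" if "y \<in> S" for y
      using frechet_derivative_cong_open[OF assms(1) that Suc.prems(2)] by simp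
  qed
  ultimately show ?case by simp
qed

text \<open>Each derivative of \<open>f \<circ> A\<close> along an affine \<open>A\<close> is a derivative of \<open>f\<close> in a fixed direction,
  precomposed with \<open>A\<close>, so induction on the order works. Openness of \<open>T\<close> makes the derivative at a
  point depend only on values in \<open>T\<close>.\<close>

lemma Ck_on_compose_affine:
  assumes L: "bounded_linear L" and T: "open T" and f: "Ck_on n S f"
    and sub: "\<And>u. u \<in> T \<Longrightarrow> a + L u \<in> S"
  shows "Ck_on n T (\<lambda>u. f (a + L u))"
  using f
proof (induction n arbitrary: f)
  case 0
  have "continuous_on T (\<lambda>u. a + L u)"
    using L by (intro continuous_intros linear_continuous_on)
  with 0 sub show ?case
    by (auto intro: continuous_on_compose2)
next
  case (Suc n)
  have D: "((\<lambda>u. f (a + L u)) has_derivative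
      (\<lambda>v. frechet_derivative f (at (a + L u)) (L v))) (at u)" if "u \<in> T" for u
  proof -
    have "((\<lambda>u. a + L u) has_derivative L) (at u)"
      using bounded_linear_imp_has_derivative[OF L] by (auto intro!: derivative_eq_intros)
    moreover have "(f has_derivative frechet_derivative f (at (a + L u))) (at (a + L u))"
      using Suc.prems sub[OF that] by (simp add: frechet_derivative_works)
    ultimately show ?thesis by (rule has_derivative_compose)
  qed
  have "Ck_on n T (\<lambda>u. frechet_derivative (\<lambda>u. f (a + L u)) (at u) v)" for v
  proof (rule Ck_on_cong[OF T])
    show "Ck_on n T (\<lambda>u. frechet_derivative f (at (a + L u)) (L v))"
      using Suc.prems by (intro Suc.IH) simp
  qed (simp add: frechet_derivative_at[OF D, symmetric])
  then show ?case using D by (auto simp: differentiable_def)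
qed

lemma chart_inj_on:
  assumes "smooth_manifold M" and "(U, \<phi>) \<in> atlas M"
  shows "inj_on \<phi> U"
proof -
  have h: "homeomorphic_map (subtopology (mtop M) U) (top_of_set (\<phi> ` U)) \<phi>"
    and o: "openin (mtop M) U"
    using assms unfolding smooth_manifold_def by auto
  show ?thesis
    using homeomorphic_imp_injective_map[OF h] openin_subset[OF o] by (simp add: inf_absorb2)
qed

lemma chart_image_open:
  assumes M: "smooth_manifold M" and c: "(U, \<phi>) \<in> atlas M" and R: "openin (mtop M) R" "R \<subseteq> U"
  shows "open (\<phi> ` R)"
proof -
  have h: "homeomorphic_map (subtopology (mtop M) U) (top_of_set (\<phi> ` U)) \<phi>"
    and o: "openin (mtop M) U" "open (\<phi> ` U)"
    using M c unfolding smooth_manifold_def by auto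
  have "openin (subtopology (mtop M) U) R"
    using R o(1) by (simp add: openin_open_subtopology)
  then have "openin (top_of_set (\<phi> ` U)) (\<phi> ` R)"
    using homeomorphic_imp_open_map[OF h] by (simp add: open_map_def)
  then show ?thesis using o(2) openin_open_trans by blast
qed

text \<open>This covers both inclusions of a slice into a product, which in product charts are the affine
  maps \<open>u \<mapsto> (u, c)\<close> and \<open>u \<mapsto> (c, u)\<close>. About \<open>P\<close> one assumes just the existence of
  suitable charts, so that for \<open>G \<times> \<gg>\<^sup>*\<close> the global chart of the linear factor can be inserted directly.\<close>

lemma smooth_map_compose_chart_affine:
  assumes M: "smooth_manifold M" and f: "smooth_map P Q f" and Q: "smooth_manifold Q"
    and j: "continuous_map (mtop M) (mtop P) j"
    and charts: "\<And>U \<phi>. (U, \<phi>) \<in> atlas M \<Longrightarrow> \<exists>W \<kappa> a L. (W, \<kappa>) \<in> atlas P \<and> inj_on \<kappa> W \<and>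
      bounded_linear L \<and> (\<forall>x\<in>U. j x \<in> W \<and> \<kappa> (j x) = a + L (\<phi> x))"
  shows "smooth_map M Q (\<lambda>x. f (j x))"
  unfolding smooth_map_on_def subtopology_topspace
proof (intro conjI, goal_cases)
  case 1
  show ?case by simp
next
  case 2
  show ?case
    using continuous_map_compose[OF j, of "mtop Q" f] f by (simp add: smooth_map_on_def o_def)
next
  case 3
  have "smooth_on (\<phi> ` {x \<in> U \<inter> topspace (mtop M). f (j x) \<in> Z}) (\<lambda>u. \<theta> (f (j (inv_into U \<phi> u))))"
    if c: "(U, \<phi>) \<in> atlas M" and d: "(Z, \<theta>) \<in> atlas Q" for U \<phi> Z \<theta>
  proof -
    obtain W \<kappa> a L where W: "(W, \<kappa>) \<in> atlas P" "inj_on \<kappa> W" and L: "bounded_linear L"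
      and jU: "\<And>x. x \<in> U \<Longrightarrow> j x \<in> W" "\<And>x. x \<in> U \<Longrightarrow> \<kappa> (j x) = a + L (\<phi> x)"
      using charts[OF c] by blast
    have oU: "openin (mtop M) U" using M c unfolding smooth_manifold_def by auto
    have oZ: "openin (mtop Q) Z" using Q d unfolding smooth_manifold_def by auto
    define R where "R = {x \<in> U \<inter> topspace (mtop M). f (j x) \<in> Z}"
    have "continuous_map (mtop M) (mtop Q) (\<lambda>x. f (j x))"
      using continuous_map_compose[OF j, of "mtop Q" f] f by (simp add: smooth_map_on_def o_def)
    from openin_continuous_map_preimage[OF this oZ] oU
    have "openin (mtop M) (U \<inter> {x \<in> topspace (mtop M). f (j x) \<in> Z})" by blast
    also have "U \<inter> {x \<in> topspace (mtop M). f (j x) \<in> Z} = R" by (auto simp: R_def)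
    finally have oR: "open (\<phi> ` R)"
      by (rule chart_image_open[OF M c]) (auto simp: R_def)
    have sm: "smooth_on (\<kappa> ` {w \<in> W \<inter> topspace (mtop P). f w \<in> Z}) (\<lambda>u. \<theta> (f (inv_into W \<kappa> u)))"
      using f W(1) d unfolding smooth_map_on_def by auto
    have jtop: "j x \<in> topspace (mtop P)" if "x \<in> topspace (mtop M)" for x
      using continuous_map_image_subset_topspace[OF j] that by auto
    have "Ck_on n (\<phi> ` R) (\<lambda>u. \<theta> (f (j (inv_into U \<phi> u))))" for n
    proof (rule Ck_on_cong[OF oR])
      show "Ck_on n (\<phi> ` R) (\<lambda>u. \<theta> (f (inv_into W \<kappa> (a + L u))))"
      proof (rule Ck_on_compose_affine[OF L oR])
        show "Ck_on n (\<kappa> ` {w \<in> W \<inter> topspace (mtop P). f w \<in> Z}) (\<lambda>u. \<theta> (f (inv_into W \<kappa> u)))"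
          using sm by (simp add: smooth_on_def)
        fix u assume "u \<in> \<phi> ` R"
        then obtain x where x: "x \<in> U" "x \<in> topspace (mtop M)" "f (j x) \<in> Z" "u = \<phi> x"
          by (auto simp: R_def)
        then have "a + L u = \<kappa> (j x)" using jU by simp
        then show "a + L u \<in> \<kappa> ` {w \<in> W \<inter> topspace (mtop P). f w \<in> Z}"
          using x jU(1) jtop by auto
      qed
      fix u assume "u \<in> \<phi> ` R"
      then obtain x where x: "x \<in> U" "u = \<phi> x" by (auto simp: R_def)
      then have "a + L u = \<kappa> (j x)" using jU by simp
      then show "\<theta> (f (inv_into W \<kappa> (a + L u))) = \<theta> (f (j (inv_into U \<phi> u)))"
        using x jU(1) W(2) chart_inj_on[OF M c] by simp
    qed
    then show ?thesis by (simp add: smooth_on_def R_def)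
  qed
  then show ?case by auto
qed

lemma smooth_map_slice_left:
  fixes M :: "('a, 'e::real_normed_vector) manifold" and N :: "('b, 'f::real_normed_vector) manifold"
  assumes M: "smooth_manifold M" and Q: "smooth_manifold Q"
    and f: "smooth_map (prod_manifold M N) Q f"
    and V: "(V, \<psi>) \<in> atlas N" "inj_on \<psi> V" "y \<in> V" "y \<in> topspace (mtop N)"
  shows "smooth_map M Q (\<lambda>x. f (x, y))"
proof (rule smooth_map_compose_chart_affine[OF M f Q])
  show "continuous_map (mtop M) (mtop (prod_manifold M N)) (\<lambda>x. (x, y))"
    using V(4) by (simp add: prod_manifold_def continuous_map_pairwise o_def)
  fix U and \<phi> :: "'a \<Rightarrow> 'e" assume c: "(U, \<phi>) \<in> atlas M"
  have "(U \<times> V, map_prod \<phi> \<psi>) \<in> atlas (prod_manifold M N)"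
    using c V(1) by (auto simp: prod_manifold_def)
  moreover have "inj_on (map_prod \<phi> \<psi>) (U \<times> V)"
    using chart_inj_on[OF M c] V(2) by (rule map_prod_inj_on)
  moreover have "bounded_linear (\<lambda>u::'e. (u, 0::'f))"
    by (intro bounded_linear_Pair bounded_linear_ident bounded_linear_zero)
  ultimately show "\<exists>W \<kappa> a L. (W, \<kappa>) \<in> atlas (prod_manifold M N) \<and> inj_on \<kappa> W \<and>
      bounded_linear L \<and> (\<forall>x\<in>U. (x, y) \<in> W \<and> \<kappa> (x, y) = a + L (\<phi> x))"
    using V(3) by (intro exI[of _ "U \<times> V"] exI[of _ "map_prod \<phi> \<psi>"] exI[of _ "(0, \<psi> y)"]
        exI[of _ "\<lambda>u. (u, 0)"]) simp
qed

lemma smooth_map_slice_right: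
  fixes M :: "('a, 'e::real_normed_vector) manifold" and N :: "('b, 'f::real_normed_vector) manifold"
  assumes M: "smooth_manifold M" and Q: "smooth_manifold Q"
    and f: "smooth_map (prod_manifold N M) Q f"
    and V: "(V, \<psi>) \<in> atlas N" "inj_on \<psi> V" "y \<in> V" "y \<in> topspace (mtop N)"
  shows "smooth_map M Q (\<lambda>x. f (y, x))"
proof (rule smooth_map_compose_chart_affine[OF M f Q])
  show "continuous_map (mtop M) (mtop (prod_manifold N M)) (\<lambda>x. (y, x))"
    using V(4) by (simp add: prod_manifold_def continuous_map_pairwise o_def)
  fix U and \<phi> :: "'a \<Rightarrow> 'e" assume c: "(U, \<phi>) \<in> atlas M"
  have "(V \<times> U, map_prod \<psi> \<phi>) \<in> atlas (prod_manifold N M)"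
    using c V(1) by (auto simp: prod_manifold_def)
  moreover have "inj_on (map_prod \<psi> \<phi>) (V \<times> U)"
    using V(2) chart_inj_on[OF M c] by (rule map_prod_inj_on)
  moreover have "bounded_linear (\<lambda>u::'e. (0::'f, u))"
    by (intro bounded_linear_Pair bounded_linear_ident bounded_linear_zero)
  ultimately show "\<exists>W \<kappa> a L. (W, \<kappa>) \<in> atlas (prod_manifold N M) \<and> inj_on \<kappa> W \<and>
      bounded_linear L \<and> (\<forall>x\<in>U. (y, x) \<in> W \<and> \<kappa> (y, x) = a + L (\<phi> x))"
    using V(3) by (intro exI[of _ "V \<times> U"] exI[of _ "map_prod \<psi> \<phi>"] exI[of _ "(\<psi> y, 0)"]
        exI[of _ "\<lambda>u. (0, u)"]) simp
qed

section \<open>Tangent maps\<close>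

text \<open>The group laws hold only on the carrier, so identities between maps of the group hold only
  there; this still determines the tangent map, because a chart has an open image.\<close>

lemma mderiv_cong:
  assumes M: "smooth_manifold M" and x: "x \<in> topspace (mtop M)"
    and eq: "\<And>y. y \<in> topspace (mtop M) \<Longrightarrow> f y = g y"
  shows "mderiv M N f x = mderiv M N g x"
proof -
  obtain U \<phi> where c: "chart_at M x = (U, \<phi>)" by (cases "chart_at M x")
  have U: "(U, \<phi>) \<in> atlas M" "x \<in> U"
    using chart_at_in_atlas[OF M x] c by auto
  have oU: "openin (mtop M) U" and opU: "open (\<phi> ` U)"
    using M U(1) unfolding smooth_manifold_def by auto
  have eqU: "f (inv_into U \<phi> u) = g (inv_into U \<phi> u)" if "u \<in> \<phi> ` U" for u
    using eq openin_subset[OF oU] inv_into_into[OF that] by blast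
  have "frechet_derivative (\<lambda>u. \<psi> (f (inv_into U \<phi> u))) (at (\<phi> x)) =
      frechet_derivative (\<lambda>u. \<psi> (g (inv_into U \<phi> u))) (at (\<phi> x))" for \<psi> :: "'c \<Rightarrow> 'd"
    by (rule frechet_derivative_cong_open[OF opU]) (use U(2) eqU in auto)
  then show ?thesis
    by (simp add: mderiv_def c eq[OF x] split: prod.split)
qed

lemma mderiv_const: "mderiv M N (\<lambda>_. c) x = 0"
  by (simp add: mderiv_def frechet_derivative_const zero_blinfun_def split: prod.split)

lemma chart_at_vs_manifold: "chart_at vs_manifold y = (UNIV, \<lambda>x. x)"
proof -
  have "(c \<in> atlas vs_manifold \<and> y \<in> fst c) \<longleftrightarrow> c = (UNIV, \<lambda>x. x)" for c :: "'a set \<times> ('a \<Rightarrow> 'a)"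
    by (auto simp: vs_manifold_def)
  then show ?thesis by (simp add: chart_at_def)
qed

text \<open>Smoothness of a map is more than the chain rule at one point uses. With this pointwise notion,
  a chain of three maps has a tangent map without any appeal to smoothness of composites.\<close>

definition has_mderiv ::
  "('a, 'e::real_normed_vector) manifold \<Rightarrow> ('b, 'f::real_normed_vector) manifold \<Rightarrow>
   ('a \<Rightarrow> 'b) \<Rightarrow> 'a \<Rightarrow> 'e \<Rightarrow>\<^sub>L 'f \<Rightarrow> bool"
where
  "has_mderiv M N f x D \<longleftrightarrow> continuous_map (mtop M) (mtop N) f \<and>
     (\<forall>U \<phi> V \<psi>. chart_at M x = (U, \<phi>) \<longrightarrow> chart_at N (f x) = (V, \<psi>) \<longrightarrow>
       ((\<lambda>u. \<psi> (f (inv_into U \<phi> u))) has_derivative blinfun_apply D) (at (\<phi> x)))"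

lemma smooth_map_has_mderiv:
  assumes "smooth_manifold M" and "smooth_manifold N" and "smooth_map M N f"
    and "x \<in> topspace (mtop M)"
  shows "has_mderiv M N f x (mderiv M N f x)"
  using has_derivative_mderiv[OF assms] assms(3) by (auto simp: has_mderiv_def smooth_map_on_def)

lemma has_mderiv_imp_mderiv:
  assumes "has_mderiv M N f x D"
  shows "mderiv M N f x = D"
proof -
  obtain U \<phi> V \<psi> where c: "chart_at M x = (U, \<phi>)" "chart_at N (f x) = (V, \<psi>)"
    by (meson surj_pair)
  then have "((\<lambda>u. \<psi> (f (inv_into U \<phi> u))) has_derivative blinfun_apply D) (at (\<phi> x))"
    using assms by (simp add: has_mderiv_def)
  from frechet_derivative_at[OF this, symmetric] show ?thesis
    by (simp add: mderiv_def c blinfun_apply_inverse)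
qed

lemma has_mderiv_compose:
  assumes M: "smooth_manifold M" and N: "smooth_manifold N" and x: "x \<in> topspace (mtop M)"
    and f: "has_mderiv M N f x A" and g: "has_mderiv N Q g (f x) B"
  shows "has_mderiv M Q (\<lambda>y. g (f y)) x (B o\<^sub>L A)"
  unfolding has_mderiv_def
proof (intro conjI allI impI)
  have cont: "continuous_map (mtop M) (mtop N) f" using f by (simp add: has_mderiv_def)
  show "continuous_map (mtop M) (mtop Q) (\<lambda>y. g (f y))"
    using continuous_map_compose[OF cont, of "mtop Q" g] g by (simp add: has_mderiv_def o_def)
  fix U \<phi> Z \<theta> assume c: "chart_at M x = (U, \<phi>)" and e: "chart_at Q (g (f x)) = (Z, \<theta>)"
  obtain V \<psi> where d: "chart_at N (f x) = (V, \<psi>)" by (cases "chart_at N (f x)")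
  have fx: "f x \<in> topspace (mtop N)"
    using continuous_map_image_subset_topspace[OF cont] x by auto
  have U: "(U, \<phi>) \<in> atlas M" "x \<in> U" and V: "(V, \<psi>) \<in> atlas N" "f x \<in> V"
    using chart_at_in_atlas[OF M x] chart_at_in_atlas[OF N fx] c d by auto
  have oU: "openin (mtop M) U" and oV: "openin (mtop N) V"
    using M U(1) N V(1) unfolding smooth_manifold_def by auto
  define R where "R = {y \<in> U. f y \<in> V}"
  have "openin (mtop M) (U \<inter> {y \<in> topspace (mtop M). f y \<in> V})"
    using openin_continuous_map_preimage[OF cont oV] oU by blast
  also have "U \<inter> {y \<in> topspace (mtop M). f y \<in> V} = R"
    using openin_subset[OF oU] by (auto simp: R_def)
  finally have oR: "open (\<phi> ` R)"
    by (rule chart_image_open[OF M U(1)]) (auto simp: R_def)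
  have "((\<lambda>u. \<psi> (f (inv_into U \<phi> u))) has_derivative blinfun_apply A) (at (\<phi> x))"
    and "((\<lambda>u. \<theta> (g (inv_into V \<psi> u))) has_derivative blinfun_apply B) (at (\<psi> (f x)))"
    using f g c d e by (auto simp: has_mderiv_def)
  then have "((\<lambda>u. \<theta> (g (inv_into V \<psi> (\<psi> (f (inv_into U \<phi> u)))))) has_derivative
      blinfun_apply (B o\<^sub>L A)) (at (\<phi> x))"
    using has_derivative_compose[of "\<lambda>u. \<psi> (f (inv_into U \<phi> u))" _ "\<phi> x" UNIV
        "\<lambda>u. \<theta> (g (inv_into V \<psi> u))" "blinfun_apply B"] U(2) chart_inj_on[OF M U(1)]
    by (simp add: blinfun_apply_blinfun_compose[abs_def])
  then show "((\<lambda>u. \<theta> (g (f (inv_into U \<phi> u)))) has_derivative blinfun_apply (B o\<^sub>L A)) (at (\<phi> x))"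
  proof (rule has_derivative_transform_within_open[OF _ oR])
    show "\<phi> x \<in> \<phi> ` R" using U V by (auto simp: R_def)
    fix u assume "u \<in> \<phi> ` R"
    then show "\<theta> (g (inv_into V \<psi> (\<psi> (f (inv_into U \<phi> u))))) = \<theta> (g (f (inv_into U \<phi> u)))"
      using chart_inj_on[OF M U(1)] chart_inj_on[OF N V(1)] by (auto simp: R_def)
  qed
qed

section \<open>Translations and the adjoint action\<close>

lemma lie_groupD:
  assumes "lie_group G"
  shows "group G" and "smooth_manifold (man G)" and "topspace (mtop (man G)) = carrier G"
    and "smooth_map (prod_manifold (man G) (man G)) (man G) (\<lambda>(x, y). x \<otimes>\<^bsub>G\<^esub> y)"
  using assms by (auto simp: lie_group_def)

lemma lie_group_chart:
  assumes G: "lie_group G" and g: "g \<in> carrier G"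
  obtains V \<psi> where "(V, \<psi>) \<in> atlas (man G)" "inj_on \<psi> V" "g \<in> V"
proof -
  have g': "g \<in> topspace (mtop (man G))" using g lie_groupD(3)[OF G] by simp
  show ?thesis
    using that[of "fst (chart_at (man G) g)" "snd (chart_at (man G) g)"]
      chart_at_in_atlas[OF lie_groupD(2)[OF G] g'] chart_inj_on[OF lie_groupD(2)[OF G]]
    by simp
qed

lemma smooth_right_translation:
  assumes G: "lie_group G" and g: "g \<in> carrier G"
  shows "smooth_map (man G) (man G) (\<lambda>x. x \<otimes>\<^bsub>G\<^esub> g)"
proof -
  obtain V \<psi> where V: "(V, \<psi>) \<in> atlas (man G)" "inj_on \<psi> V" "g \<in> V"
    using lie_group_chart[OF G g] .
  then show ?thesis
    using smooth_map_slice_left[OF lie_groupD(2,2,4)[OF G] V] g lie_groupD(3)[OF G] by simp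
qed

lemma smooth_left_translation:
  assumes G: "lie_group G" and g: "g \<in> carrier G"
  shows "smooth_map (man G) (man G) (\<lambda>x. g \<otimes>\<^bsub>G\<^esub> x)"
proof -
  obtain V \<psi> where V: "(V, \<psi>) \<in> atlas (man G)" "inj_on \<psi> V" "g \<in> V"
    using lie_group_chart[OF G g] .
  then show ?thesis
    using smooth_map_slice_right[OF lie_groupD(2,2,4)[OF G] V] g lie_groupD(3)[OF G] by simp
qed

lemma mderiv_group_cong:
  assumes G: "lie_group G" and "x \<in> carrier G" and "\<And>y. y \<in> carrier G \<Longrightarrow> f y = g y"
  shows "mderiv (man G) N f x = mderiv (man G) N g x"
  using assms by (intro mderiv_cong) (auto simp: lie_groupD)

lemma mderiv_group_compose:
  assumes G: "lie_group G" and "smooth_map (man G) (man G) f" and "smooth_map (man G) (man G) f'"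
    and "x \<in> carrier G"
  shows "mderiv (man G) (man G) (\<lambda>y. f' (f y)) x =
    mderiv (man G) (man G) f' (f x) o\<^sub>L mderiv (man G) (man G) f x"
  using mderiv_compose[OF lie_groupD(2,2,2)[OF G] assms(2,3)] assms(4) by (simp add: lie_groupD(3)[OF G])

text \<open>The next three laws are the chain rule applied to associativity of the multiplication. Writing
  \<open>Ad\<close> as a product of two translations, its multiplicativity follows from them: they move the two
  left translations together and the two right translations together.\<close>

lemma ltrans_mult:
  assumes G: "lie_group G" and "g \<in> carrier G" and "k \<in> carrier G" and "x \<in> carrier G"
  shows "ltrans G g (k \<otimes>\<^bsub>G\<^esub> x) o\<^sub>L ltrans G k x = ltrans G (g \<otimes>\<^bsub>G\<^esub> k) x"
proof -
  interpret group G using lie_groupD(1)[OF G] .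
  have "ltrans G (g \<otimes>\<^bsub>G\<^esub> k) x = mderiv (man G) (man G) (\<lambda>y. g \<otimes>\<^bsub>G\<^esub> (k \<otimes>\<^bsub>G\<^esub> y)) x"
    unfolding ltrans_def by (rule mderiv_group_cong[OF G]) (use assms in \<open>auto simp: m_assoc\<close>)
  also have "\<dots> = ltrans G g (k \<otimes>\<^bsub>G\<^esub> x) o\<^sub>L ltrans G k x"
    unfolding ltrans_def
    by (intro mderiv_group_compose smooth_left_translation) (use assms in auto)
  finally show ?thesis ..
qed

lemma rtrans_mult:
  assumes G: "lie_group G" and "g \<in> carrier G" and "k \<in> carrier G" and "x \<in> carrier G"
  shows "rtrans G g (x \<otimes>\<^bsub>G\<^esub> k) o\<^sub>L rtrans G k x = rtrans G (k \<otimes>\<^bsub>G\<^esub> g) x"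
proof -
  interpret group G using lie_groupD(1)[OF G] .
  have "rtrans G (k \<otimes>\<^bsub>G\<^esub> g) x = mderiv (man G) (man G) (\<lambda>y. y \<otimes>\<^bsub>G\<^esub> k \<otimes>\<^bsub>G\<^esub> g) x"
    unfolding rtrans_def by (rule mderiv_group_cong[OF G]) (use assms in \<open>auto simp: m_assoc\<close>)
  also have "\<dots> = rtrans G g (x \<otimes>\<^bsub>G\<^esub> k) o\<^sub>L rtrans G k x"
    unfolding rtrans_def
    by (intro mderiv_group_compose smooth_right_translation) (use assms in auto)
  finally show ?thesis ..
qed

lemma rtrans_ltrans_commute:
  assumes G: "lie_group G" and "g \<in> carrier G" and "k \<in> carrier G" and "x \<in> carrier G"
  shows "rtrans G g (k \<otimes>\<^bsub>G\<^esub> x) o\<^sub>L ltrans G k x = ltrans G k (x \<otimes>\<^bsub>G\<^esub> g) o\<^sub>L rtrans G g x"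
proof -
  interpret group G using lie_groupD(1)[OF G] .
  have "rtrans G g (k \<otimes>\<^bsub>G\<^esub> x) o\<^sub>L ltrans G k x =
      mderiv (man G) (man G) (\<lambda>y. k \<otimes>\<^bsub>G\<^esub> y \<otimes>\<^bsub>G\<^esub> g) x"
    unfolding ltrans_def rtrans_def
    by (intro mderiv_group_compose[symmetric] smooth_left_translation smooth_right_translation)
      (use assms in auto)
  also have "\<dots> = mderiv (man G) (man G) (\<lambda>y. k \<otimes>\<^bsub>G\<^esub> (y \<otimes>\<^bsub>G\<^esub> g)) x"
    by (rule mderiv_group_cong[OF G]) (use assms in \<open>auto simp: m_assoc\<close>)
  also have "\<dots> = ltrans G k (x \<otimes>\<^bsub>G\<^esub> g) o\<^sub>L rtrans G g x"
    unfolding ltrans_def rtrans_def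
    by (intro mderiv_group_compose smooth_left_translation smooth_right_translation)
      (use assms in auto)
  finally show ?thesis .
qed

lemma blinfun_compose_assoc: "(A o\<^sub>L B) o\<^sub>L C = A o\<^sub>L (B o\<^sub>L C)"
  by (rule blinfun_eqI) simp

lemma ltrans_one:
  assumes G: "lie_group G" and x: "x \<in> carrier G"
  shows "ltrans G \<one>\<^bsub>G\<^esub> x = id_blinfun"
proof -
  interpret group G using lie_groupD(1)[OF G] .
  note M = lie_groupD(2)[OF G]
  obtain U \<phi> where c: "chart_at (man G) x = (U, \<phi>)" by (cases "chart_at (man G) x")
  have U: "(U, \<phi>) \<in> atlas (man G)" "x \<in> U"
    using chart_at_in_atlas[OF M, of x] x c by (simp_all add: lie_groupD(3)[OF G])
  have op: "open (\<phi> ` U)" using M U(1) unfolding smooth_manifold_def by auto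
  have "ltrans G \<one>\<^bsub>G\<^esub> x = mderiv (man G) (man G) (\<lambda>y. y) x"
    unfolding ltrans_def by (rule mderiv_group_cong[OF G]) (use x in auto)
  also have "\<dots> = Blinfun (frechet_derivative (\<lambda>u. \<phi> (inv_into U \<phi> u)) (at (\<phi> x)))"
    by (simp add: mderiv_def c)
  also have "frechet_derivative (\<lambda>u. \<phi> (inv_into U \<phi> u)) (at (\<phi> x)) = (\<lambda>v. v)"
    using frechet_derivative_cong_open[OF op, of "\<phi> x" "\<lambda>u. \<phi> (inv_into U \<phi> u)" "\<lambda>u. u"] U(2)
    by (simp add: f_inv_into_f frechet_derivative_ident)
  finally show ?thesis by (simp add: id_blinfun_def id_def)
qed

lemma Ad_eq_ltrans_rtrans:
  assumes G: "lie_group G" and g: "g \<in> carrier G"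
  shows "Ad G g = ltrans G g (inv\<^bsub>G\<^esub> g) o\<^sub>L rtrans G (inv\<^bsub>G\<^esub> g) \<one>\<^bsub>G\<^esub>"
proof -
  interpret group G using lie_groupD(1)[OF G] .
  have "Ad G g = mderiv (man G) (man G) (\<lambda>x. g \<otimes>\<^bsub>G\<^esub> (x \<otimes>\<^bsub>G\<^esub> inv\<^bsub>G\<^esub> g)) \<one>\<^bsub>G\<^esub>"
    unfolding Ad_def by (rule mderiv_group_cong[OF G]) (use g in \<open>auto simp: m_assoc\<close>)
  also have "\<dots> = mderiv (man G) (man G) (\<lambda>y. g \<otimes>\<^bsub>G\<^esub> y) (\<one>\<^bsub>G\<^esub> \<otimes>\<^bsub>G\<^esub> inv\<^bsub>G\<^esub> g) o\<^sub>L
      mderiv (man G) (man G) (\<lambda>x. x \<otimes>\<^bsub>G\<^esub> inv\<^bsub>G\<^esub> g) \<one>\<^bsub>G\<^esub>"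
    by (intro mderiv_group_compose smooth_left_translation smooth_right_translation)
      (use G g in auto)
  finally show ?thesis using g by (simp add: ltrans_def rtrans_def)
qed

lemma Ad_mult:
  assumes G: "lie_group G" and g: "g \<in> carrier G" and k: "k \<in> carrier G"
  shows "Ad G (g \<otimes>\<^bsub>G\<^esub> k) = Ad G g o\<^sub>L Ad G k"
proof -
  interpret group G using lie_groupD(1)[OF G] .
  let ?g = "inv\<^bsub>G\<^esub> g" and ?k = "inv\<^bsub>G\<^esub> k"
  have comm: "rtrans G ?g \<one>\<^bsub>G\<^esub> o\<^sub>L ltrans G k ?k = ltrans G k (?k \<otimes>\<^bsub>G\<^esub> ?g) o\<^sub>L rtrans G ?g ?k"
    using rtrans_ltrans_commute[OF G, of ?g k ?k] g k by simp
  have L: "ltrans G g ?g o\<^sub>L ltrans G k (?k \<otimes>\<^bsub>G\<^esub> ?g) = ltrans G (g \<otimes>\<^bsub>G\<^esub> k) (?k \<otimes>\<^bsub>G\<^esub> ?g)"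
    using ltrans_mult[OF G, of g k "?k \<otimes>\<^bsub>G\<^esub> ?g"] g k by (simp add: m_assoc[symmetric])
  have R: "rtrans G ?g ?k o\<^sub>L rtrans G ?k \<one>\<^bsub>G\<^esub> = rtrans G (?k \<otimes>\<^bsub>G\<^esub> ?g) \<one>\<^bsub>G\<^esub>"
    using rtrans_mult[OF G, of ?g ?k "\<one>\<^bsub>G\<^esub>"] g k by simp
  have "Ad G g o\<^sub>L Ad G k = ltrans G g ?g o\<^sub>L (rtrans G ?g \<one>\<^bsub>G\<^esub> o\<^sub>L ltrans G k ?k) o\<^sub>L rtrans G ?k \<one>\<^bsub>G\<^esub>"
    using g k by (simp add: Ad_eq_ltrans_rtrans[OF G] blinfun_compose_assoc)
  also have "\<dots> = (ltrans G g ?g o\<^sub>L ltrans G k (?k \<otimes>\<^bsub>G\<^esub> ?g)) o\<^sub>L (rtrans G ?g ?k o\<^sub>L rtrans G ?k \<one>\<^bsub>G\<^esub>)"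
    by (simp only: comm blinfun_compose_assoc)
  also have "\<dots> = Ad G (g \<otimes>\<^bsub>G\<^esub> k)"
    using g k by (simp add: L R Ad_eq_ltrans_rtrans[OF G] inv_mult_group)
  finally show ?thesis ..
qed

text \<open>The dual reverses composition, so \<open>Ad\<^sup>*\<close> below is a right action.\<close>

lemma dual_dual: "dual A (dual B \<mu>) = dual (B o\<^sub>L A) \<mu>"
  by (simp add: dual_def blinfun_compose_assoc)

lemma dual_diff: "dual A (\<mu> - \<nu>) = dual A \<mu> - dual A \<nu>"
  by (simp add: dual_def blinfun_eqI blinfun.bilinear_simps)

lemma dual_scaleR: "dual A (r *\<^sub>R \<mu>) = r *\<^sub>R dual A \<mu>"
  by (simp add: dual_def blinfun_eqI blinfun.bilinear_simps)

lemma dual_Ad_mult: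
  assumes "lie_group G" and "g \<in> carrier G" and "k \<in> carrier G"
  shows "dual (Ad G k) (dual (Ad G g) \<mu>) = dual (Ad G (g \<otimes>\<^bsub>G\<^esub> k)) \<mu>"
  by (simp add: dual_dual Ad_mult assms)

text \<open>Translating a tangent vector at the identity by \<open>g\<close> on the right and then by \<open>g\<inverse>\<close> on the left
  is \<open>Ad\<close> of \<open>g\<inverse>\<close>; dually, this turns a left momentum at \<open>g\<close> into the right one.\<close>

lemma cotangent_right_covector_at:
  assumes G: "lie_group G" and g: "g \<in> carrier G"
  shows "cotangent_right G g (covector_at G g \<mu>) = dual (Ad G (inv\<^bsub>G\<^esub> g)) \<mu>"
proof -
  interpret group G using lie_groupD(1)[OF G] .
  show ?thesis
    using g by (simp add: cotangent_right_def covector_at_def dual_dual Ad_eq_ltrans_rtrans[OF G])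
qed

lemma dual_Ad_cotangent_left:
  assumes G: "lie_group G" and g: "g \<in> carrier G"
  shows "dual (Ad G (inv\<^bsub>G\<^esub> g)) (cotangent_left G g p) = cotangent_right G g p"
proof -
  interpret group G using lie_groupD(1)[OF G] .
  have "ltrans G g \<one>\<^bsub>G\<^esub> o\<^sub>L ltrans G (inv\<^bsub>G\<^esub> g) g = id_blinfun"
    using ltrans_mult[OF G, of g "inv\<^bsub>G\<^esub> g" g] g by (simp add: ltrans_one[OF G])
  then have "ltrans G g \<one>\<^bsub>G\<^esub> o\<^sub>L Ad G (inv\<^bsub>G\<^esub> g) = rtrans G g \<one>\<^bsub>G\<^esub>"
    using g by (simp add: Ad_eq_ltrans_rtrans[OF G] blinfun_compose_assoc[symmetric])
      (simp add: blinfun_eqI)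
  then show ?thesis by (simp add: cotangent_left_def cotangent_right_def dual_dual)
qed

section \<open>The momentum map of left translation\<close>

lemma lie_subgroupD:
  assumes "lie_group G" and K: "lie_subgroup K G"
  shows "smooth_manifold (man K)" and "topspace (mtop (man K)) = carrier K"
    and "carrier K \<subseteq> carrier G" and "\<one>\<^bsub>K\<^esub> \<in> carrier K" and "\<one>\<^bsub>K\<^esub> = \<one>\<^bsub>G\<^esub>"
    and "smooth_map (man K) (man G) (\<lambda>x. x)"
proof -
  interpret G: group G using lie_groupD(1)[OF assms(1)] .
  have LK: "lie_group K" and sub: "subgroup (carrier K) G"
    and mult: "\<And>x y. x \<in> carrier K \<Longrightarrow> y \<in> carrier K \<Longrightarrow> x \<otimes>\<^bsub>K\<^esub> y = x \<otimes>\<^bsub>G\<^esub> y"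
    using K by (auto simp: lie_subgroup_def)
  interpret K: group K using lie_groupD(1)[OF LK] .
  show "smooth_manifold (man K)" "topspace (mtop (man K)) = carrier K"
    using LK by (simp_all add: lie_groupD)
  show inc: "carrier K \<subseteq> carrier G" using sub by (rule subgroup.subset)
  show one: "\<one>\<^bsub>K\<^esub> \<in> carrier K" by simp
  \<comment> \<open>The two units agree because the unit of the subgroup is idempotent in the larger group.\<close>
  have "\<one>\<^bsub>K\<^esub> \<otimes>\<^bsub>G\<^esub> \<one>\<^bsub>K\<^esub> = \<one>\<^bsub>K\<^esub>" using mult[OF one one] by simp
  then show "\<one>\<^bsub>K\<^esub> = \<one>\<^bsub>G\<^esub>" using one inc by (metis G.l_cancel_one subsetD)
  show "smooth_map (man K) (man G) (\<lambda>x. x)" using K by (simp add: lie_subgroup_def)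
qed

text \<open>The orbit map \<open>k \<mapsto> k g\<close> is the inclusion followed by right translation by \<open>g\<close>, so the generator
  of left translation at \<open>g\<close> is \<open>\<zeta> \<mapsto> \<zeta> g\<close>.\<close>

lemma infinitesimal_generator_left_translation:
  assumes G: "lie_group G" and K: "lie_subgroup K G" and g: "g \<in> carrier G"
  shows "infinitesimal_generator K (man G) (\<lambda>k g. k \<otimes>\<^bsub>G\<^esub> g) g =
    rtrans G g \<one>\<^bsub>G\<^esub> o\<^sub>L lie_algebra_inclusion K G"
  using mderiv_compose[OF lie_subgroupD(1)[OF G K] lie_groupD(2,2)[OF G] lie_subgroupD(6)[OF G K]
      smooth_right_translation[OF G g], of "\<one>\<^bsub>K\<^esub>"] lie_subgroupD(2,4,5)[OF G K]
  by (simp add: infinitesimal_generator_def rtrans_def lie_algebra_inclusion_def)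

lemma momentum_map_left_translation:
  assumes "lie_group G" and "lie_subgroup K G" and "g \<in> carrier G"
  shows "momentum_map K (man G) (\<lambda>k g. k \<otimes>\<^bsub>G\<^esub> g) (g, p) =
    dual (lie_algebra_inclusion K G) (cotangent_right G g p)"
proof -
  have "momentum_map K (man G) (\<lambda>k g. k \<otimes>\<^bsub>G\<^esub> g) (g, p) =
      Blinfun (blinfun_apply (p o\<^sub>L infinitesimal_generator K (man G) (\<lambda>k g. k \<otimes>\<^bsub>G\<^esub> g) g))"
    by (simp add: momentum_map_def blinfun_apply_blinfun_compose[abs_def])
  then show ?thesis
    by (simp only: blinfun_apply_inverse infinitesimal_generator_left_translation[OF assms]
        dual_dual cotangent_right_def) (simp only: dual_def)
qed

section \<open>Invariant Hamiltonians\<close>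

lemma smooth_hamiltonian_slice:
  assumes G: "lie_group G" and h: "smooth_hamiltonian G h"
  shows "smooth_map (man G) vs_manifold (\<lambda>x. h x \<mu>)"
  using smooth_map_slice_left[OF lie_groupD(2)[OF G] smooth_manifold_real
      h[unfolded smooth_hamiltonian_def], of UNIV "\<lambda>x. x" \<mu>]
  by (simp add: vs_manifold_def)

text \<open>Along an orbit \<open>k \<mapsto> k g\<close> the Hamiltonian is constant, and the directions tangent to the
  orbit are the right translates to \<open>g\<close> of the Lie algebra of the subgroup.\<close>

lemma dH_dg_invariant:
  assumes G: "lie_group G" and K: "lie_subgroup K G" and h: "smooth_hamiltonian G h"
    and inv: "left_invariant_hamiltonian K G h" and g: "g \<in> carrier G"
  shows "dual (lie_algebra_inclusion K G) (cotangent_right G g (dH_dg G h g \<mu>)) = 0"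
proof -
  interpret group G using lie_groupD(1)[OF G] .
  note KD = lie_subgroupD[OF G K]
  have hs: "smooth_map (man G) vs_manifold (\<lambda>x. h x \<mu>)"
    using smooth_hamiltonian_slice[OF G h] .
  have one: "\<one>\<^bsub>G\<^esub> \<in> topspace (mtop (man G))" by (simp add: lie_groupD[OF G])
  have right: "has_mderiv (man G) (man G) (\<lambda>x. x \<otimes>\<^bsub>G\<^esub> g) \<one>\<^bsub>G\<^esub> (rtrans G g \<one>\<^bsub>G\<^esub>)"
    unfolding rtrans_def
    by (rule smooth_map_has_mderiv[OF lie_groupD(2,2)[OF G] smooth_right_translation[OF G g] one])
  have "has_mderiv (man G) vs_manifold (\<lambda>x. h x \<mu>) (\<one>\<^bsub>G\<^esub> \<otimes>\<^bsub>G\<^esub> g) (dH_dg G h g \<mu>)"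
    using smooth_map_has_mderiv[OF lie_groupD(2)[OF G] smooth_manifold_real hs, of g] g
    by (simp add: dH_dg_def lie_groupD[OF G])
  from has_mderiv_compose[OF lie_groupD(2,2)[OF G] one right this]
  have orbit: "has_mderiv (man G) vs_manifold (\<lambda>x. h (x \<otimes>\<^bsub>G\<^esub> g) \<mu>) \<one>\<^bsub>K\<^esub>
      (dH_dg G h g \<mu> o\<^sub>L rtrans G g \<one>\<^bsub>G\<^esub>)"
    by (simp add: KD(5))
  have "has_mderiv (man K) (man G) (\<lambda>x. x) \<one>\<^bsub>K\<^esub> (lie_algebra_inclusion K G)"
    unfolding lie_algebra_inclusion_def
    using KD by (intro smooth_map_has_mderiv) (auto simp: lie_groupD[OF G])
  from has_mderiv_imp_mderiv[OF has_mderiv_compose[OF KD(1) lie_groupD(2)[OF G] _ this orbit]]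
  have "(dH_dg G h g \<mu> o\<^sub>L rtrans G g \<one>\<^bsub>G\<^esub>) o\<^sub>L lie_algebra_inclusion K G =
      mderiv (man K) vs_manifold (\<lambda>k. h (k \<otimes>\<^bsub>G\<^esub> g) \<mu>) \<one>\<^bsub>K\<^esub>"
    using KD by simp
  also have "\<dots> = mderiv (man K) vs_manifold (\<lambda>k. h g \<mu>) \<one>\<^bsub>K\<^esub>"
    using inv g KD by (intro mderiv_cong) (auto simp: left_invariant_hamiltonian_def)
  also have "\<dots> = 0" by (rule mderiv_const)
  finally show ?thesis by (simp add: cotangent_right_def dual_def)
qed

lemma dH_dg_step_hamiltonian:
  assumes G: "lie_group G" and g: "g \<in> carrier G"
    and h: "smooth_hamiltonian G h" and hs: "\<And>i. i \<in> {1..N} \<Longrightarrow> smooth_hamiltonian G (hs i)"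
  shows "dH_dg G (step_hamiltonian h N hs \<Delta>t \<Delta>W k) g \<mu> =
    dH_dg G h g \<mu> + (\<Sum>i=1..N. (\<Delta>W i k / \<Delta>t) *\<^sub>R dH_dg G (hs i) g \<mu>)"
proof -
  obtain U \<phi> where c: "chart_at (man G) g = (U, \<phi>)" by (cases "chart_at (man G) g")
  have g': "g \<in> topspace (mtop (man G))" using g by (simp add: lie_groupD[OF G])
  have D: "((\<lambda>u. f (inv_into U \<phi> u) \<mu>) has_derivative blinfun_apply (dH_dg G f g \<mu>)) (at (\<phi> g))"
    if "smooth_hamiltonian G f" for f
    unfolding dH_dg_def
    by (rule has_derivative_mderiv[OF lie_groupD(2)[OF G] smooth_manifold_real
          smooth_hamiltonian_slice[OF G that] g' c chart_at_vs_manifold])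
  have "((\<lambda>u. hs i (inv_into U \<phi> u) \<mu> * (\<Delta>W i k / \<Delta>t)) has_derivative
      (\<lambda>v. dH_dg G (hs i) g \<mu> v * (\<Delta>W i k / \<Delta>t))) (at (\<phi> g))" if "i \<in> {1..N}" for i
    using D[OF hs[OF that]] by (rule has_derivative_mult_left)
  then have "((\<lambda>u. \<Sum>i=1..N. hs i (inv_into U \<phi> u) \<mu> * (\<Delta>W i k / \<Delta>t)) has_derivative
      (\<lambda>v. \<Sum>i=1..N. dH_dg G (hs i) g \<mu> v * (\<Delta>W i k / \<Delta>t))) (at (\<phi> g))"
    by (rule has_derivative_sum)
  from has_derivative_add[OF D[OF h] this]
  have "((\<lambda>u. step_hamiltonian h N hs \<Delta>t \<Delta>W k (inv_into U \<phi> u) \<mu>) has_derivative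
      blinfun_apply (dH_dg G h g \<mu> + (\<Sum>i=1..N. (\<Delta>W i k / \<Delta>t) *\<^sub>R dH_dg G (hs i) g \<mu>))) (at (\<phi> g))"
    unfolding step_hamiltonian_def
    by (rule has_derivative_eq_rhs, intro ext)
      (simp add: blinfun.bilinear_simps blinfun.sum_left mult.commute)
  from frechet_derivative_at[OF this, symmetric] show ?thesis
    by (subst dH_dg_def) (simp add: mderiv_def c chart_at_vs_manifold blinfun_apply_inverse)
qed

lemma dH_dg_step_hamiltonian_invariant:
  assumes G: "lie_group G" and K: "lie_subgroup K G" and g: "g \<in> carrier G"
    and h: "smooth_hamiltonian G h" "left_invariant_hamiltonian K G h"
    and hs: "\<forall>i\<in>{1..N}. smooth_hamiltonian G (hs i)" "\<forall>i\<in>{1..N}. left_invariant_hamiltonian K G (hs i)"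
  shows "dual (lie_algebra_inclusion K G)
    (cotangent_right G g (dH_dg G (step_hamiltonian h N hs \<Delta>t \<Delta>W k) g \<mu>)) = 0"
proof -
  let ?F = "\<lambda>p. dual (lie_algebra_inclusion K G) (cotangent_right G g p)"
  have lin: "linear ?F"
    by (intro linearI) (auto simp: cotangent_right_def dual_def blinfun_eqI blinfun.bilinear_simps)
  have "?F (dH_dg G (step_hamiltonian h N hs \<Delta>t \<Delta>W k) g \<mu>) =
      ?F (dH_dg G h g \<mu>) + (\<Sum>i=1..N. (\<Delta>W i k / \<Delta>t) *\<^sub>R ?F (dH_dg G (hs i) g \<mu>))"
    using hs(1) by (simp only: dH_dg_step_hamiltonian[OF G g h(1)] linear_add[OF lin]
        linear_sum[OF lin] linear_scale[OF lin])
  also have "\<dots> = 0"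
    using h hs by (simp add: dH_dg_invariant[OF G K _ _ g])
  finally show ?thesis .
qed

section \<open>Conservation along the scheme\<close>

text \<open>Here \<open>a\<close> and \<open>c\<close> are the left momenta at the beginning of the step and at the internal
  stage \<open>x\<close>, and \<open>Ad\<^sup>*(x\<inverse> g\<^sub>1) c\<close> is the one at its end. Applying \<open>Ad\<^sup>*(x\<inverse>)\<close> turns the balance
  equation at \<open>x\<close> into one between right momenta, since \<open>g\<^sub>0\<inverse> x x\<inverse> = g\<^sub>0\<inverse>\<close> and \<open>x\<inverse> g\<^sub>1 g\<^sub>1\<inverse> = x\<inverse>\<close>.\<close>

lemma step_momentum_balance:
  assumes G: "lie_group G" and car: "g0 \<in> carrier G" "x \<in> carrier G" "g1 \<in> carrier G"
    and eq: "r *\<^sub>R (dual (Ad G (inv\<^bsub>G\<^esub> g0 \<otimes>\<^bsub>G\<^esub> x)) a - c) = cotangent_left G x p"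
  shows "r *\<^sub>R (dual (Ad G (inv\<^bsub>G\<^esub> g0)) a -
      dual (Ad G (inv\<^bsub>G\<^esub> g1)) (dual (Ad G (inv\<^bsub>G\<^esub> x \<otimes>\<^bsub>G\<^esub> g1)) c)) = cotangent_right G x p"
proof -
  interpret group G using lie_groupD(1)[OF G] .
  have "dual (Ad G (inv\<^bsub>G\<^esub> x)) (r *\<^sub>R (dual (Ad G (inv\<^bsub>G\<^esub> g0 \<otimes>\<^bsub>G\<^esub> x)) a - c)) = cotangent_right G x p"
    using dual_Ad_cotangent_left[OF G car(2)] by (simp add: eq)
  then show ?thesis
    using car by (simp add: dual_diff dual_scaleR dual_Ad_mult[OF G] m_assoc)
qed

theorem proposition4p1:
  fixes G :: "('a, 'e::real_normed_vector) lie_group"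
    and K :: "('a, 'f::real_normed_vector) lie_group"
    and \<tau> :: "'e \<Rightarrow> 'a" and U :: "'e set"
    and h :: "'a \<Rightarrow> ('e \<Rightarrow>\<^sub>L real) \<Rightarrow> real"
    and hs :: "nat \<Rightarrow> 'a \<Rightarrow> ('e \<Rightarrow>\<^sub>L real) \<Rightarrow> real"
    and N M :: nat and \<Delta>t :: real
    and P :: "'w measure" and W :: "nat \<Rightarrow> real \<Rightarrow> 'w \<Rightarrow> real"
  assumes "lie_group G" and "lie_subgroup K G"
    and "lie_retraction G \<tau> U"
    and "smooth_hamiltonian G h" and "\<forall>i\<in>{1..N}. smooth_hamiltonian G (hs i)"
    and "left_invariant_hamiltonian K G h" and "\<forall>i\<in>{1..N}. left_invariant_hamiltonian K G (hs i)"
    and "\<Delta>t > 0" and "M \<ge> 1"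
    and "independent_wiener_processes P N W"
  defines "J \<equiv> momentum_map K (man G) (\<lambda>k g. k \<otimes>\<^bsub>G\<^esub> g)"
    and "H \<equiv> \<lambda>\<omega>. step_hamiltonian h N hs \<Delta>t (wiener_increment W \<Delta>t \<omega>)"
  shows "(\<forall>g\<in>carrier G. \<forall>p. J (g, p) = dual (lie_algebra_inclusion K G) (cotangent_right G g p)) \<and>
         (\<forall>\<omega>\<in>space P. \<forall>z0 zM. discrete_flow G \<tau> U \<Delta>t M (H \<omega>) z0 zM \<longrightarrow> J zM = J z0)"
proof (intro conjI ballI allI impI)
  note G = assms(1) and K = assms(2)
  let ?i = "lie_algebra_inclusion K G"
  show J: "J (g, p) = dual ?i (cotangent_right G g p)" if "g \<in> carrier G" for g p
    unfolding J_def by (rule momentum_map_left_translation[OF G K that])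
  fix \<omega> z0 zM
  assume "discrete_flow G \<tau> U \<Delta>t M (H \<omega>) z0 zM"
  then obtain g gt \<mu>1 \<mu>2 where sol: "midpoint_solution G \<tau> U \<Delta>t M (H \<omega>) g gt \<mu>1 \<mu>2"
    and z: "let \<xi>t1 = discrete_velocity G \<tau> U \<Delta>t (g 0) (gt 1);
                \<xi>M = discrete_velocity G \<tau> U \<Delta>t (gt M) (g M)
            in z0 = (g 0, covector_at G (g 0) (dual (dtau_inv G \<tau> U (\<Delta>t *\<^sub>R \<xi>t1)) (\<mu>1 1))) \<and>
               zM = (g M, covector_at G (g M)
                   (dual (Ad G (\<tau> (\<Delta>t *\<^sub>R \<xi>M))) (dual (dtau_inv G \<tau> U (\<Delta>t *\<^sub>R \<xi>M)) (\<mu>2 M))))"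
    unfolding discrete_flow_def by blast
  define \<xi> where "\<xi> k = \<Delta>t *\<^sub>R discrete_velocity G \<tau> U \<Delta>t (gt k) (g k)" for k
  define \<xi>t where "\<xi>t k = \<Delta>t *\<^sub>R discrete_velocity G \<tau> U \<Delta>t (g (k - 1)) (gt k)" for k
  \<comment> \<open>\<open>a k\<close>, \<open>c k\<close> and \<open>b k\<close> are the left momenta at the beginning, the internal stage and the end
    of step \<open>k\<close>.\<close>
  define a where "a k = dual (dtau_inv G \<tau> U (\<xi>t k)) (\<mu>1 k)" for k
  define c where "c k = dual (dtau_inv G \<tau> U (\<xi> k)) (\<mu>2 k)" for k
  define b where "b k = dual (Ad G (\<tau> (\<xi> k))) (c k)" for k
  have car: "g k \<in> carrier G" if "k \<le> M" for k
    using sol that by (simp add: midpoint_solution_def Let_def)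
  have cart: "gt k \<in> carrier G" if "k \<in> {1..M}" for k
    using sol that by (simp add: midpoint_solution_def Let_def)
  have dom: "inv\<^bsub>G\<^esub> (gt k) \<otimes>\<^bsub>G\<^esub> g k \<in> \<tau> ` U" "inv\<^bsub>G\<^esub> (g (k - 1)) \<otimes>\<^bsub>G\<^esub> gt k \<in> \<tau> ` U"
    if "k \<in> {1..M}" for k
    using sol that unfolding midpoint_solution_def Let_def by blast+
  have tau: "\<tau> (\<xi> k) = inv\<^bsub>G\<^esub> (gt k) \<otimes>\<^bsub>G\<^esub> g k" "\<tau> (\<xi>t k) = inv\<^bsub>G\<^esub> (g (k - 1)) \<otimes>\<^bsub>G\<^esub> gt k"
    if "k \<in> {1..M}" for k
    using dom[OF that] \<open>\<Delta>t > 0\<close>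
    by (simp_all add: \<xi>_def \<xi>t_def discrete_velocity_def f_inv_into_f)
  have balance: "(1 / \<Delta>t) *\<^sub>R (dual (Ad G (\<tau> (\<xi>t k))) (a k) - c k) =
      cotangent_left G (gt k) (dH_dg G (H \<omega> k) (gt k) ((1/2) *\<^sub>R (\<mu>1 k + \<mu>2 k)))"
    if "k \<in> {1..M}" for k
    using sol that unfolding midpoint_solution_def Let_def a_def c_def \<xi>_def \<xi>t_def by blast
  have matching: "b k = a (Suc k)" if "k \<in> {1..<M}" for k
    using sol that unfolding midpoint_solution_def Let_def a_def b_def c_def \<xi>_def \<xi>t_def by blast
  have conserved: "dual ?i (dual (Ad G (inv\<^bsub>G\<^esub> (g k))) (b k)) =
      dual ?i (dual (Ad G (inv\<^bsub>G\<^esub> (g (k - 1)))) (a k))" if k: "k \<in> {1..M}" for k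
  proof -
    have "(1 / \<Delta>t) *\<^sub>R (dual (Ad G (inv\<^bsub>G\<^esub> (g (k - 1)))) (a k) - dual (Ad G (inv\<^bsub>G\<^esub> (g k))) (b k)) =
        cotangent_right G (gt k) (dH_dg G (H \<omega> k) (gt k) ((1/2) *\<^sub>R (\<mu>1 k + \<mu>2 k)))"
      unfolding b_def tau(1)[OF k]
      by (rule step_momentum_balance[OF G _ cart[OF k] _ balance[OF k, unfolded tau(2)[OF k]]])
        (use k in \<open>auto intro!: car\<close>)
    then have "dual ?i ((1 / \<Delta>t) *\<^sub>R (dual (Ad G (inv\<^bsub>G\<^esub> (g (k - 1)))) (a k) -
        dual (Ad G (inv\<^bsub>G\<^esub> (g k))) (b k))) = 0"
      unfolding H_def
      using dH_dg_step_hamiltonian_invariant[OF G K cart[OF k]] assms(4-7) by simp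
    then show ?thesis
      using \<open>\<Delta>t > 0\<close> by (simp add: dual_scaleR dual_diff)
  qed
  have telescope: "dual ?i (dual (Ad G (inv\<^bsub>G\<^esub> (g k))) (b k)) =
      dual ?i (dual (Ad G (inv\<^bsub>G\<^esub> (g 0))) (a 1))" if "1 \<le> k" "k \<le> M" for k
    using that
  proof (induction k rule: dec_induct)
    case base
    then show ?case using conserved[of 1] by simp
  next
    case (step k)
    then show ?case using conserved[of "Suc k"] matching[of k] by simp
  qed
  have z0: "z0 = (g 0, covector_at G (g 0) (a 1))" and zM: "zM = (g M, covector_at G (g M) (b M))"
    using z by (simp_all add: Let_def a_def b_def c_def \<xi>_def \<xi>t_def)
  have "J zM = dual ?i (dual (Ad G (inv\<^bsub>G\<^esub> (g M))) (b M))"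
    by (simp add: zM J car cotangent_right_covector_at[OF G])
  also have "\<dots> = dual ?i (dual (Ad G (inv\<^bsub>G\<^esub> (g 0))) (a 1))"
    using telescope \<open>M \<ge> 1\<close> by simp
  also have "\<dots> = J z0"
    by (simp add: z0 J car cotangent_right_covector_at[OF G])
  finally show "J zM = J z0" .
qed

end
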